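(* Let $H$ be a separable real Hilbert space and let $\phi:\mathcal P_2(H)\to\mathbb R\cup\{+\infty\}$ be a proper function. The following properties are equivalent: 1. $\phi$ is totally convex and lower semicontinuous; 2. $\phi\circ\iota$ is convex and lower semicontinuous in $\mathcal H$; 3. $\phi=\phi^{\star\star}$; 4. there exists a set $G\subset\mathcal P_2(H)\times\mathbb R$ such that $\phi(\mu)=\sup_{(\nu,a)\in G}\big([\mu,\nu]-a\big)$ for every $\mu\in\mathcal P_2(H)$.
   Context: $\mathcal P_2(H)$ is the space of Borel probability measures $\mu$ on $H$ with $\int_H|x|^2\,d\mu<\infty$, endowed with the 2-Wasserstein metric $w_2$ (with respect to which semicontinuity is understood). $\Gamma(\mu,\nu)$ is the set of couplings of $\mu,\nu$, and $[\mu,\nu]:=\max\{\int\langle x,y\rangle\,d\gamma:\gamma\in\Gamma(\mu,\nu)\}$. Proper means not identically $+\infty$. Kantorovich–Legendre–Fenchel conjugate: $\phi^\star(\nu):=\sup_{\mu\in\mathcal P_2(H)}\big([\nu,\mu]-\phi(\mu)\big)$ and $\phi^{\star\star}:=(\phi^\star)^\star$, defined by the same formula (if $\phi^\star\equiv+\infty$ then $\phi^{\star\star}\equiv-\infty$). A function $\phi:\mathcal P_2(H)\to\mathbb R\cup\{+\infty\}$ is totally convex if for every $\boldsymbol\mu\in\mathcal P_2(H\times H)$ with marginals $\mu_0,\mu_1$ and every $t\in[0,1]$, $\phi((\pi_t)_\sharp\boldsymbol\mu)\le(1-t)\phi(\mu_0)+t\phi(\mu_1)$, where $\pi_t(x_1,x_2)=(1-t)x_1+tx_2$.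 $(Q,\mathcal F_Q,\mathbb M)$ is a fixed standard Borel space with a nonatomic probability measure $\mathbb M$, $\mathcal H:=L^2(Q,\mathbb M;H)$, and $\iota:\mathcal H\to\mathcal P_2(H)$, $\iota(X):=X_\sharp\mathbb M$. *)

theory Defs
  imports "HOL-Probability.Probability"
begin

section \<open>The Wasserstein space\<close>

definition P2 :: "'a::real_normed_vector measure set" where
  "P2 = {\<mu>. prob_space \<mu> \<and> sets \<mu> = sets borel \<and> integrable \<mu> (\<lambda>x. (norm x)\<^sup>2)}"

definition couplings ::
  "'h::{real_inner, polish_space} measure \<Rightarrow> 'h measure \<Rightarrow> ('h \<times> 'h) measure set" where
  "couplings \<mu> \<nu> =
     {\<gamma>. prob_space \<gamma> \<and> sets \<gamma> = sets borel \<and> distr \<gamma> borel fst = \<mu> \<and> distr \<gamma> borel snd = \<nu>}"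

definition w2 :: "'h::{real_inner, polish_space} measure \<Rightarrow> 'h measure \<Rightarrow> real" where
  "w2 \<mu> \<nu> = sqrt (INF \<gamma>\<in>couplings \<mu> \<nu>. \<integral>(x, y). (norm (x - y))\<^sup>2 \<partial>\<gamma>)"

text \<open>
  The maximal correlation \<open>[\<mu>, \<nu>]\<close> of two measures in \<^const>\<open>P2\<close>. It is the maximum of
  \<open>\<integral>\<langle>x, y\<rangle> d\<gamma>\<close> over the couplings; as the maximum is attained on \<^const>\<open>P2\<close>, it is written
  as a supremum. Its value is finite on \<^const>\<open>P2\<close>, where every integrand is integrable.
\<close>

definition max_corr :: "'h::{real_inner, polish_space} measure \<Rightarrow> 'h measure \<Rightarrow> ereal" where
  "max_corr \<mu> \<nu> = (SUP \<gamma>\<in>couplings \<mu> \<nu>. ereal (\<integral>(x, y). x \<bullet> y \<partial>\<gamma>))"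

section \<open>Functionals on the Wasserstein space\<close>

text \<open>
  Functionals are total functions into \<^typ>\<open>ereal\<close>; only their values on \<^const>\<open>P2\<close> matter.
\<close>

definition proper_on :: "'a set \<Rightarrow> ('a \<Rightarrow> ereal) \<Rightarrow> bool" where
  "proper_on S f \<longleftrightarrow> (\<exists>x\<in>S. f x \<noteq> \<infinity>)"

text \<open>
  Lower semicontinuity for the topology on \<open>S\<close> induced by a (pseudo)metric \<open>d\<close>.
\<close>

definition lsc_on :: "'a set \<Rightarrow> ('a \<Rightarrow> 'a \<Rightarrow> real) \<Rightarrow> ('a \<Rightarrow> ereal) \<Rightarrow> bool" where
  "lsc_on S d f \<longleftrightarrow> (\<forall>x\<in>S. \<forall>c. c < f x \<longrightarrow> (\<exists>\<delta>>0. \<forall>y\<in>S. d x y < \<delta> \<longrightarrow> c < f y))"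

text \<open>
  The convention \<open>0 * \<infinity> = 0\<close> of \<^typ>\<open>ereal\<close> is harmless in the convexity inequalities below:
  for \<open>t = 0\<close> and \<open>t = 1\<close> they hold trivially.
\<close>

definition totally_convex :: "('h::{real_inner, polish_space} measure \<Rightarrow> ereal) \<Rightarrow> bool" where
  "totally_convex \<phi> \<longleftrightarrow>
     (\<forall>\<mu>\<in>(P2 :: ('h \<times> 'h) measure set). \<forall>t\<in>{0..1::real}.
        \<phi> (distr \<mu> borel (\<lambda>(x1, x2). (1 - t) *\<^sub>R x1 + t *\<^sub>R x2))
          \<le> ereal (1 - t) * \<phi> (distr \<mu> borel fst) + ereal t * \<phi> (distr \<mu> borel snd))"

definition kl_conj ::
  "('h::{real_inner, polish_space} measure \<Rightarrow> ereal) \<Rightarrow> 'h measure \<Rightarrow> ereal" where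
  "kl_conj \<phi> \<nu> = (SUP \<mu>\<in>P2. max_corr \<nu> \<mu> - \<phi> \<mu>)"

section \<open>The Lagrangian parametrization\<close>

definition standard_borel :: "'q measure \<Rightarrow> bool" where
  "standard_borel M \<longleftrightarrow>
     (\<exists>T. completely_metrizable_space T \<and> second_countable T \<and> topspace T = space M \<and>
          sets M = sigma_sets (topspace T) {U. openin T U})"

definition nonatomic :: "'q measure \<Rightarrow> bool" where
  "nonatomic M \<longleftrightarrow>
     (\<forall>A\<in>sets M. measure M A > 0 \<longrightarrow>
        (\<exists>B\<in>sets M. B \<subseteq> A \<and> 0 < measure M B \<and> measure M B < measure M A))"

text \<open>
  The space \<open>L\<^sup>2(Q, M; H)\<close> is represented by the square-integrable functions themselves, with the
  \<open>L\<^sup>2\<close> pseudometric, rather than by their almost-everywhere equivalence classes. Since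
  \<open>push M X\<close> depends only on the class of \<open>X\<close>, convexity and lower semicontinuity of
  \<open>\<phi> \<circ> push M\<close> mean the same on representatives as on the quotient.
\<close>

definition L2_space :: "'q measure \<Rightarrow> ('q \<Rightarrow> 'h::{real_inner, polish_space}) set" where
  "L2_space M = {X \<in> borel_measurable M. integrable M (\<lambda>q. (norm (X q))\<^sup>2)}"

definition L2_distance ::
  "'q measure \<Rightarrow> ('q \<Rightarrow> 'h::{real_inner, polish_space}) \<Rightarrow> ('q \<Rightarrow> 'h) \<Rightarrow> real" where
  "L2_distance M X Y = sqrt (\<integral>q. (norm (X q - Y q))\<^sup>2 \<partial>M)"

definition push :: "'q measure \<Rightarrow> ('q \<Rightarrow> 'h::{real_inner, polish_space}) \<Rightarrow> 'h measure" where
  "push M X = distr M borel X"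

definition convex_L2 ::
  "'q measure \<Rightarrow> (('q \<Rightarrow> 'h::{real_inner, polish_space}) \<Rightarrow> ereal) \<Rightarrow> bool" where
  "convex_L2 M F \<longleftrightarrow>
     (\<forall>X\<in>L2_space M. \<forall>Y\<in>L2_space M. \<forall>t\<in>{0..1::real}.
        F (\<lambda>q. (1 - t) *\<^sub>R X q + t *\<^sub>R Y q) \<le> ereal (1 - t) * F X + ereal t * F Y)"

end

theory Submission
  imports Defs
begin

text \<open>
  Since \<open>M\<close> is standard and nonatomic, every law on a Polish space is the law of a random variable on
  \<open>M\<close>; hence couplings are joint laws of pairs in \<open>L\<^sup>2\<close>, and the implication from 1 to 2 is immediate.
  If \<open>\<phi> \<circ> \<iota>\<close> is convex and lower semicontinuous, projecting onto its epigraph in \<open>L\<^sup>2 \<times> \<real>\<close>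
  exhibits it as a supremum of affine functions \<open>X \<mapsto> E\<langle>X, Y\<rangle> - a\<close>. Given a fixed \<open>Y\<close>, any coupling
  of the law of \<open>Y\<close> with a law \<open>\<mu>\<close> is realized up to \<open>\<epsilon>\<close> in correlation by some \<open>X\<close> of law \<open>\<mu>\<close>;
  as \<open>\<phi> \<circ> \<iota>\<close> depends only on the law, such a minorant therefore improves to
  \<open>\<phi> \<mu> \<ge> [\<mu>, \<iota> Y] - a\<close>, which is \<open>\<phi> = \<phi>\<^sup>\<star>\<^sup>\<star>\<close>. The same rearrangement shows that
  \<open>[\<cdot>, \<nu>]\<close> is totally convex and lower semicontinuous, properties inherited by suprema.
\<close>

text \<open>\<open>L2_space M\<close> consists of functions, not of points of a Hilbert space, so
  completeness and the projection theorem are proved for a pseudometric, and distance zero gives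
  equality only almost everywhere. Two obstacles shape the argument. The supporting hyperplane of
  the epigraph may be vertical and then gives no affine minorant by itself. And a coupling need not
  be realized exactly once \<open>X\<close> is fixed, so optimal couplings are never invoked: every
  claim about \<open>max_corr\<close> or \<open>w2\<close> goes through a strict inequality and a
  nearly optimal pair. The set \<open>G\<close> of the last statement is the graph of the conjugate
  over the points where it is finite.\<close>

section \<open>Realization of laws on atomless spaces\<close>

text \<open>In base 3 with digits 0 and 1 the tail after each digit is less than one unit, so rounding
  down recovers the digits; base 2 would not be injective.\<close>
definition ternary :: "(nat \<Rightarrow> bool) \<Rightarrow> real" where
  "ternary b = (\<Sum>n. of_bool (b n) * (1/3) ^ n)"

lemma ternary_digit: "\<lfloor>3 ^ n * ternary b\<rfloor> mod 3 = of_bool (b n)"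
proof -
  let ?t = "\<lambda>i. of_bool (b i) * (1/3::real) ^ i"
  have sm: "summable (\<lambda>i. (1/3::real) ^ i)" by (rule summable_geometric) simp
  have s: "summable ?t"
    by (rule summable_comparison_test[OF _ sm]) (auto intro!: exI[of _ 0])
  \<comment> \<open>Scaled by \<open>3 ^ n\<close>, the earlier digits contribute the multiple
    \<open>3 * S\<close>, digit \<open>n\<close> contributes itself, and the later digits contribute
    \<open>T\<close>, which is at most 1/2.\<close>
  define S where "S = (\<Sum>i<n. of_bool (b i) * 3 ^ (n - Suc i) :: int)"
  define T where "T = (\<Sum>i. of_bool (b (i + Suc n)) * (1/3::real) ^ (i + 1))"
  have sm2: "(\<lambda>i. (1/3::real) ^ (i + 1)) sums (1/2)"
    using sums_mult[OF geometric_sums[of "1/3::real"], of "1/3"] by simp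
  have sT: "summable (\<lambda>i. of_bool (b (i + Suc n)) * (1/3::real) ^ (i + 1))"
    by (rule summable_comparison_test[OF _ sums_summable[OF sm2]]) (auto intro!: exI[of _ 0])
  have T0: "0 \<le> T" unfolding T_def by (rule suminf_nonneg[OF sT]) simp
  have "T \<le> (\<Sum>i. (1/3::real) ^ (i + 1))"
    unfolding T_def by (rule suminf_le[OF _ sT sums_summable[OF sm2]]) auto
  also have "\<dots> = 1/2" using sm2 by (simp add: sums_iff)
  finally have T1: "T < 1" by simp
  have head: "3 ^ n * (\<Sum>i<Suc n. ?t i) = of_int (3 * S + of_bool (b n))"
  proof -
    have *: "(3::real) ^ n * (1/3) ^ i = 3 * 3 ^ (n - Suc i)" if i: "i < n" for i
    proof -
      obtain j where "n = Suc (i + j)" using less_imp_Suc_add[OF i] by auto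
      then show ?thesis by (simp add: power_add power_one_over)
    qed
    have "3 ^ n * (\<Sum>i<n. ?t i) = (\<Sum>i<n. of_bool (b i) * ((3::real) ^ n * (1/3) ^ i))"
      unfolding sum_distrib_left by (intro sum.cong refl mult.left_commute)
    also have "\<dots> = (\<Sum>i<n. of_bool (b i) * (3 * 3 ^ (n - Suc i)))"
      by (intro sum.cong refl) (use * in auto)
    also have "\<dots> = 3 * (\<Sum>i<n. of_bool (b i) * 3 ^ (n - Suc i))"
      unfolding sum_distrib_left by (intro sum.cong refl mult.left_commute)
    also have "\<dots> = of_int (3 * S)" unfolding S_def of_int_mult of_int_sum by simp
    finally have "3 ^ n * (\<Sum>i<n. ?t i) = of_int (3 * S)" .
    moreover have "3 ^ n * ?t n = of_int (of_bool (b n))" by (simp add: power_one_over)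
    ultimately show ?thesis by (simp only: sum.lessThan_Suc distrib_left of_int_add)
  qed
  have tail: "3 ^ n * (\<Sum>i. ?t (i + Suc n)) = T"
  proof -
    have "3 ^ n * ?t (i + Suc n) = of_bool (b (i + Suc n)) * (1/3) ^ (i + 1)" for i
      by (simp add: power_add power_one_over)
    then show ?thesis
      using suminf_mult[OF summable_ignore_initial_segment[OF s, of "Suc n"], of "3 ^ n"]
      by (simp only: T_def)
  qed
  have "ternary b = (\<Sum>i. ?t (i + Suc n)) + (\<Sum>i<Suc n. ?t i)"
    unfolding ternary_def by (rule suminf_split_initial_segment[OF s])
  then have "3 ^ n * ternary b = T + of_int (3 * S + of_bool (b n))"
    using head tail by (simp only: distrib_left)
  then have "\<lfloor>3 ^ n * ternary b\<rfloor> = 3 * S + of_bool (b n)"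
    using T0 T1 by linarith
  then show ?thesis by (cases "b n") simp_all
qed

lemma ternary_inject: "ternary b = ternary c \<longleftrightarrow> b = c"
proof
  assume "ternary b = ternary c"
  then have "of_bool (b n) = (of_bool (c n) :: int)" for n
    using ternary_digit[of n b] ternary_digit[of n c] by simp
  then show "b = c" by (intro ext) (metis of_bool_eq_iff)
qed simp

lemma measurable_ternary [measurable (raw)]:
  assumes [measurable]: "\<And>n. Measurable.pred M (\<lambda>x. P x n)"
  shows "(\<lambda>x. ternary (P x)) \<in> borel_measurable M"
  unfolding ternary_def by measurable

section \<open>Borel encoding of a Polish space in the real line\<close>

lemma dense_sequence:
  obtains a :: "nat \<Rightarrow> 'a::{metric_space, second_countable_topology}"
  where "\<And>x e. 0 < e \<Longrightarrow> \<exists>i. dist x (a i) < e"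
proof -
  obtain D :: "'a set" where D: "countable D" "\<And>X. open X \<Longrightarrow> X \<noteq> {} \<Longrightarrow> \<exists>d\<in>D. d \<in> X"
    by (metis countable_dense_setE)
  have "\<exists>i. dist x (from_nat_into D i) < e" if "e > 0" for x e
    using D(2)[of "ball x e"] that from_nat_into_surj[OF D(1)] by fastforce
  then show thesis by (rule that)
qed

text \<open>A point \<open>x\<close> is encoded by the answers to all questions whether
  \<open>x\<close> is within \<open>(1/2) ^ n\<close> of \<open>a i\<close>. Decoding takes, for
  each \<open>n\<close>, the first \<open>a i\<close> answering yes; these converge to
  \<open>x\<close>. Only a left inverse of \<open>f\<close> is built, so the range of
  \<open>f\<close> need not be identified.\<close>

lemma borel_retract_real:
  obtains f :: "'a::{complete_space, second_countable_topology} \<Rightarrow> real" and g :: "real \<Rightarrow> 'a"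
  where "f \<in> borel_measurable borel" "g \<in> borel_measurable borel" "\<And>x. g (f x) = x"
proof -
  obtain a :: "nat \<Rightarrow> 'a" where dense: "\<And>x e. 0 < e \<Longrightarrow> \<exists>i. dist x (a i) < e"
    by (metis dense_sequence)
  define near where "near x m = (dist x (a (fst (prod_decode m))) < (1/2) ^ snd (prod_decode m))" for x m
  define f where "f x = ternary (near x)" for x
  define i where "i n t = (LEAST i. \<lfloor>3 ^ prod_encode (i, n) * t\<rfloor> mod 3 = 1)" for n and t :: real
  \<comment> \<open>The constant \<open>a 0\<close> replaces non-Cauchy sequences, so that the limit
    exists for every \<open>t\<close> and \<open>g\<close> is measurable on the whole line.\<close>
  define h where "h n t = (if Cauchy (\<lambda>n. a (i n t)) then a (i n t) else a 0)" for n t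
  have [measurable]: "Measurable.pred borel (\<lambda>x. near x m)" for m
    unfolding near_def by measurable
  have f: "f \<in> borel_measurable borel" unfolding f_def by measurable
  have "(\<lambda>t. i n t) \<in> borel \<rightarrow>\<^sub>M count_space UNIV" for n
    unfolding i_def by measurable
  then have ai[measurable]: "(\<lambda>t. a (i n t)) \<in> borel_measurable borel" for n
    by (rule measurable_compose) simp
  have h[measurable]: "h n \<in> borel_measurable borel" for n
    unfolding h_def by measurable
  have lim: "(\<lambda>n. h n t) \<longlonglongrightarrow> lim (\<lambda>n. h n t)" for t
  proof (cases "Cauchy (\<lambda>n. a (i n t))")
    case True
    then have "h n t = a (i n t)" for n by (simp only: h_def if_True)
    then show ?thesis using Cauchy_convergent[OF True] by (simp only: convergent_LIMSEQ_iff)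
  next
    case False
    then have "h n t = a 0" for n by (simp only: h_def if_False)
    then show ?thesis using convergent_const[of "a 0"] by (simp only: convergent_LIMSEQ_iff)
  qed
  define g where "g t = lim (\<lambda>n. h n t)" for t
  have g: "g \<in> borel_measurable borel"
    by (rule borel_measurable_LIMSEQ_metric[of h], rule h, unfold g_def, rule lim)
  have "g (f x) = x" for x
  proof -
    have eq: "i n (f x) = (LEAST i. dist x (a i) < (1/2) ^ n)" for n
      unfolding i_def f_def ternary_digit by (simp add: near_def)
    have "dist x (a (i n (f x))) < (1/2) ^ n" for n
      unfolding eq by (rule LeastI_ex) (simp add: dense)
    then have "norm (dist (a (i n (f x))) x) \<le> (1/2) ^ n" for n
      by (simp add: dist_commute less_imp_le)
    then have "(\<lambda>n. dist (a (i n (f x))) x) \<longlonglongrightarrow> 0"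
      by (rule Lim_null_comparison[OF always_eventually[OF allI]])
         (simp add: LIMSEQ_realpow_zero)
    then have l: "(\<lambda>n. a (i n (f x))) \<longlonglongrightarrow> x" by (subst tendsto_dist_iff)
    then have "h n (f x) = a (i n (f x))" for n
      using LIMSEQ_imp_Cauchy[OF l] by (simp only: h_def if_True)
    with l show ?thesis unfolding g_def by (simp only: limI)
  qed
  with f g show thesis using that by blast
qed

section \<open>Probability integral transform and quantile functions\<close>

text \<open>Absence of atoms makes the distribution function continuous, so it attains every level
  in (0, 1). The last point \<open>s\<close> at level \<open>u\<close> turns the event that the
  transform is at most \<open>u\<close> into \<open>Z q \<le> s\<close>, whose probability is
  \<open>u\<close>. The uniform law is written as restricted Lebesgue measure because the quantile
  construction is stated for it.\<close>

lemma (in prob_space) distr_cdf_uniform: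
  assumes [measurable]: "Z \<in> borel_measurable M"
    and atomless: "\<And>z. prob (Z -` {z} \<inter> space M) = 0"
  shows "distr M borel (\<lambda>q. cdf (distr M borel Z) (Z q)) =
    distr (restrict_space lborel {0<..<1}) borel (\<lambda>x. x)"
proof -
  interpret L: real_distribution "distr M borel Z" by simp
  let ?F = "cdf (distr M borel Z)"
  have F_mono: "mono ?F" by (auto intro!: monoI L.cdf_nondecreasing)
  have [measurable]: "?F \<in> borel_measurable borel" by (rule borel_measurable_mono[OF F_mono])
  have cont: "isCont ?F x" for x
    using atomless[of x] by (simp add: L.isCont_cdf measure_distr)
  have F_prob: "?F x = prob {q \<in> space M. Z q \<le> x}" for x
    by (auto simp: cdf_def measure_distr intro!: arg_cong[where f=prob])
  let ?U = "distr (restrict_space lborel {0<..<1}) borel (\<lambda>x::real. x)"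
  interpret R: prob_space "restrict_space lborel {0<..<1::real}"
    by (auto simp add: emeasure_restrict_space space_restrict_space intro!: prob_spaceI)
  have id[measurable]: "(\<lambda>x::real. x) \<in> borel_measurable (restrict_space lborel {0<..<1})"
    by (rule measurable_restrict_space1) simp
  then have U: "real_distribution ?U" by (rule R.real_distribution_distr)
  have V: "real_distribution (distr M borel (\<lambda>q. ?F (Z q)))" by simp
  let ?P = "\<lambda>u. prob {q \<in> space M. ?F (Z q) \<le> u}"
  have mid: "?P u = u" if u: "0 < u" "u < 1" for u
  proof -
    have lo: "\<exists>x. ?F x < u"
      using order_tendstoD(2)[OF L.cdf_lim_at_bot u(1)] eventually_happens'[OF trivial_limit_at_bot_linorder]
      by blast
    have hi: "\<exists>x. u < ?F x"
      using order_tendstoD(1)[OF L.cdf_lim_at_top_prob u(2)] eventually_happens'[OF trivial_limit_at_top_linorder]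
      by blast
    obtain y where y: "u < ?F y" using hi by blast
    obtain w where w: "?F w < u" using lo by blast
    let ?S = "{x. ?F x \<le> u}"
    have bdd: "bdd_above ?S"
      by (rule bdd_aboveI[of _ y]) (metis L.cdf_nondecreasing le_cases mem_Collect_eq not_less order.trans y)
    have ne: "?S \<noteq> {}" using w by (auto intro: less_imp_le)
    have "closed ?S"
      by (intro closed_Collect_le continuous_at_imp_continuous_on ballI cont continuous_intros)
    then have mem: "Sup ?S \<in> ?S" by (rule closed_contains_Sup[OF ne bdd])
    have "w \<le> y"
      by (rule ccontr) (use w y L.cdf_nondecreasing[of y w] in auto)
    then obtain z where z: "?F z = u"
      using IVT[of ?F w u y] w y cont by (auto intro: less_imp_le)
    have "?F z \<le> ?F (Sup ?S)" by (intro L.cdf_nondecreasing cSup_upper bdd) (simp add: z)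
    with mem z have eq: "?F (Sup ?S) = u" by simp
    define s where "s = Sup ?S"
    have "?F x \<le> u \<longleftrightarrow> x \<le> s" for x
      using cSup_upper[OF _ bdd, of x] L.cdf_nondecreasing[of x "Sup ?S"] eq unfolding s_def by auto
    then have "?P u = prob {q \<in> space M. Z q \<le> s}" by simp
    also have "\<dots> = u" using eq F_prob[of s] by (simp only: s_def)
    finally show ?thesis .
  qed
  have P_mono: "?P u \<le> ?P v" if "u \<le> v" for u v
    by (rule finite_measure_mono) (use that in auto)
  have eqP: "?P u = max 0 (min 1 u)" for u
  proof -
    consider "u \<le> 0" | "0 < u" "u < 1" | "1 \<le> u" by linarith
    then show ?thesis
    proof cases
      case 1
      have "?P u \<le> e" if "0 < e" for e
      proof (cases "e < 1")
        case True
        then show ?thesis using mid[OF that True] P_mono[of u e] 1 that by simp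
      next
        case False
        then show ?thesis using prob_le_1[of "{q \<in> space M. ?F (Z q) \<le> u}"] by linarith
      qed
      then have "?P u \<le> 0" by (rule dense_ge)
      then show ?thesis using 1 measure_nonneg[of M "{q \<in> space M. ?F (Z q) \<le> u}"] by linarith
    next
      case 2 then show ?thesis using mid by simp
    next
      case 3
      then have "{q \<in> space M. ?F (Z q) \<le> u} = space M"
        using L.cdf_bounded_prob order.trans by auto
      then show ?thesis using 3 by (simp add: prob_space)
    qed
  qed
  show ?thesis
  proof (rule cdf_unique[OF V U], rule ext)
    fix u
    have "cdf (distr M borel (\<lambda>q. ?F (Z q))) u = ?P u"
      unfolding cdf_def[of "distr M borel (\<lambda>q. ?F (Z q))"]
      by (subst measure_distr) (auto intro!: arg_cong[where f=prob])
    moreover have "cdf ?U u = max 0 (min 1 u)"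
    proof -
      have "cdf ?U u = measure lborel ({0<..<1} \<inter> {..u})"
        by (auto simp: cdf_def measure_distr[OF id] measure_restrict_space space_restrict_space
            intro!: arg_cong[where f="measure lborel"])
      also have "\<dots> = max 0 (min 1 u)"
      proof (cases "u < 1")
        case True
        then have "{0<..<1} \<inter> {..u} = {0<..u}" by auto
        then show ?thesis using True by (cases "0 \<le> u") auto
      next
        case False
        then have "{0<..<1} \<inter> {..u} = {0<..<1}" by auto
        then show ?thesis using False by auto
      qed
      finally show ?thesis .
    qed
    ultimately show "cdf (distr M borel (\<lambda>q. ?F (Z q))) u = cdf ?U u" by (simp add: eqP)
  qed
qed

text \<open>The quantile function \<open>D.I\<close> of \<open>\<rho>\<close> is applied to the
  uniform variable built from \<open>Z\<close>. Setting it to 0 off (0, 1) makes it measurable on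
  the line and leaves the law unchanged, since the uniform law is carried by (0, 1).\<close>

lemma (in prob_space) exists_distr_real:
  fixes Z :: "'a \<Rightarrow> real"
  assumes [measurable]: "Z \<in> borel_measurable M"
    and atomless: "\<And>z. prob (Z -` {z} \<inter> space M) = 0"
    and "real_distribution \<rho>"
  obtains W where "W \<in> borel_measurable M" "distr M borel W = \<rho>"
proof -
  interpret D: cdf_distribution \<rho> unfolding cdf_distribution_def by fact
  interpret L: real_distribution "distr M borel Z" by simp
  let ?F = "cdf (distr M borel Z)"
  have "mono ?F" by (auto intro!: monoI L.cdf_nondecreasing)
  then have [measurable]: "?F \<in> borel_measurable borel" by (rule borel_measurable_mono)
  define J where "J u = (if u \<in> {0<..<1} then D.I u else 0)" for u
  have [measurable]: "J \<in> borel_measurable borel"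
    unfolding J_def
    using measurable_restrict_space_iff[of "{0<..<1::real}" borel 0 borel D.I] D.measurable_CI by auto
  have "distr M borel (\<lambda>q. J (?F (Z q))) = distr (distr M borel (\<lambda>q. ?F (Z q))) borel J"
    by (simp add: distr_distr comp_def)
  also have "\<dots> = distr (restrict_space lborel {0<..<1}) borel J"
    by (simp add: distr_cdf_uniform[OF assms(1,2)] distr_distr comp_def measurable_restrict_space1)
  also have "\<dots> = distr (restrict_space lborel {0<..<1}) borel D.I"
    by (rule distr_cong) (auto simp: J_def space_restrict_space)
  finally have "distr M borel (\<lambda>q. J (?F (Z q))) = \<rho>" by (simp add: D.distr_I_eq_M)
  then show thesis by (intro that[of "\<lambda>q. J (?F (Z q))"]) simp_all
qed

lemma (in prob_space) exists_distr:
  fixes \<rho> :: "'b::{complete_space, second_countable_topology} measure" and Z :: "'a \<Rightarrow> real"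
  assumes Z: "Z \<in> borel_measurable M" "\<And>z. prob (Z -` {z} \<inter> space M) = 0"
    and \<rho>: "prob_space \<rho>" "sets \<rho> = sets borel"
  obtains Y where "Y \<in> borel_measurable M" "distr M borel Y = \<rho>"
proof -
  interpret R: prob_space \<rho> by fact
  note \<rho>(2)[measurable_cong]
  obtain f :: "'b \<Rightarrow> real" and g
    where [measurable]: "f \<in> borel_measurable borel" "g \<in> borel_measurable borel"
      and gf: "\<And>x. g (f x) = x"
    by (rule borel_retract_real[where 'a='b]) blast
  have "real_distribution (distr \<rho> borel f)" by simp
  then obtain W where W[measurable]: "W \<in> borel_measurable M" and eq: "distr M borel W = distr \<rho> borel f"
    using exists_distr_real[OF Z] by blast
  have "distr M borel (\<lambda>q. g (W q)) = distr (distr M borel W) borel g"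
    by (simp add: distr_distr comp_def)
  also have "\<dots> = distr \<rho> borel (\<lambda>x. x)"
    by (simp add: eq distr_distr comp_def gf)
  also have "\<dots> = \<rho>" using \<rho>(2) by (simp add: distr_id2)
  finally show thesis by (intro that[of "\<lambda>q. g (W q)"]) simp_all
qed

section \<open>Random variables without atoms\<close>

text \<open>Membership in the sets of a countable base distinguishes points, because the topology is
  Hausdorff; \<open>ternary\<close> turns the sequence of memberships into one real number without
  loss.\<close>

lemma standard_borel_injection:
  assumes "standard_borel M"
  obtains f :: "'q \<Rightarrow> real" where "f \<in> borel_measurable M" "inj_on f (space M)"
proof -
  obtain T where T: "completely_metrizable_space T" "second_countable T" "topspace T = space M"
    "sets M = sigma_sets (topspace T) {U. openin T U}"
    using assms unfolding standard_borel_def by auto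
  then obtain B where B: "countable B" "\<And>V. V \<in> B \<Longrightarrow> openin T V"
    "\<And>U x. openin T U \<Longrightarrow> x \<in> U \<Longrightarrow> \<exists>V\<in>B. x \<in> V \<and> V \<subseteq> U"
    unfolding second_countable_def by metis
  have haus: "Hausdorff_space T"
    using T(1) completely_metrizable_imp_metrizable_space metrizable_imp_Hausdorff_space by blast
  define V where "V = from_nat_into (insert {} B)"
  have rV: "range V = insert {} B"
    unfolding V_def by (rule range_from_nat_into) (use B(1) in auto)
  have oV: "openin T (V n)" for n
    using B(2) rV by (metis insert_iff openin_empty rangeI)
  then have [measurable]: "V n \<in> sets M" for n unfolding T(4) by auto
  have "(\<lambda>q. ternary (\<lambda>n. q \<in> V n)) \<in> borel_measurable M" by measurable
  moreover have "inj_on (\<lambda>q. ternary (\<lambda>n. q \<in> V n)) (space M)"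
  proof (rule inj_onI, rule ccontr)
    fix x y assume xy: "x \<in> space M" "y \<in> space M" "x \<noteq> y"
      and "ternary (\<lambda>n. x \<in> V n) = ternary (\<lambda>n. y \<in> V n)"
    then have eq: "x \<in> V n \<longleftrightarrow> y \<in> V n" for n by (simp add: ternary_inject fun_eq_iff)
    obtain U W where UW: "openin T U" "x \<in> U" "openin T W" "y \<in> W" "disjnt U W"
      using haus xy T(3) unfolding Hausdorff_space_def by metis
    obtain S where S: "S \<in> B" "x \<in> S" "S \<subseteq> U" using B(3)[OF UW(1,2)] by blast
    then obtain n where "S = V n" using rV by (metis imageE insertI2)
    then show False using eq[of n] S UW by (auto simp: disjnt_def)
  qed
  ultimately show thesis using that by blast
qed

text \<open>A fibre of an injective map has at most one point, and positive mass at one point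
  contradicts \<open>nonatomic\<close>: no subset of it has strictly intermediate mass.\<close>

lemma (in prob_space) nonatomic_standard_borel_atomless_rv:
  assumes "standard_borel M" "nonatomic M"
  obtains f :: "'a \<Rightarrow> real" where "f \<in> borel_measurable M" "\<And>z. prob (f -` {z} \<inter> space M) = 0"
proof -
  obtain f :: "'a \<Rightarrow> real" where f[measurable]: "f \<in> borel_measurable M" and inj: "inj_on f (space M)"
    using standard_borel_injection[OF assms(1)] by metis
  have "prob (f -` {z} \<inter> space M) = 0" for z
  proof (rule ccontr)
    let ?A = "f -` {z} \<inter> space M"
    assume "prob ?A \<noteq> 0"
    then have "prob ?A > 0" by (simp add: zero_less_measure_iff)
    then obtain B where B: "B \<in> sets M" "B \<subseteq> ?A" "0 < prob B" "prob B < prob ?A"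
      using assms(2) measurable_sets[OF f, of "{z}"] unfolding nonatomic_def by auto
    have "B \<noteq> {}" "B \<noteq> ?A" using B by auto
    then obtain x y where "x \<in> B" "y \<in> ?A" "y \<notin> B" using B(2) by blast
    then show False using inj B(2) by (auto dest: inj_onD)
  qed
  with f show thesis using that by blast
qed

section \<open>Conditioning and rearrangement\<close>

text \<open>The assumption is one random variable without atoms because this survives conditioning:
  the same \<open>Z\<close> has null fibres under \<open>uniform_measure M A\<close> for every event
  of positive mass, so laws can be realized inside each such event.\<close>

locale atomless_prob_space = prob_space +
  assumes atomless: "\<exists>Z\<in>borel_measurable M. \<forall>z::real. prob (Z -` {z} \<inter> space M) = 0"
begin

text \<open>The conditional law of \<open>Y'\<close> on \<open>A'\<close> is realized on
  \<open>A\<close> under the conditional measure. Both conditional measures are normalized by the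
  same mass, so equal conditional laws mean equal unnormalized measures.\<close>

lemma rearrange_on_event:
  fixes Y' :: "'a \<Rightarrow> 'b::{complete_space, second_countable_topology}"
  assumes [measurable]: "A \<in> events" "A' \<in> events" "Y' \<in> borel_measurable M"
    and eq: "emeasure M A = emeasure M A'"
  shows "\<exists>Y\<in>borel_measurable M. \<forall>B\<in>sets borel. emeasure M (A \<inter> Y -` B) = emeasure M (A' \<inter> Y' -` B)"
proof (cases "emeasure M A = 0")
  case True
  have "emeasure M (A \<inter> S) = 0" "emeasure M (A' \<inter> S) = 0" for S
    using True eq emeasure_mono[of "A \<inter> S" A M] emeasure_mono[of "A' \<inter> S" A' M] by auto
  then show ?thesis by (intro bexI[of _ Y']) auto
next
  case False
  have fin: "emeasure M A \<noteq> \<infinity>" "emeasure M A' \<noteq> \<infinity>" by simp_all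
  interpret N: prob_space "uniform_measure M A" by (rule prob_space_uniform_measure) (use False in auto)
  interpret N': prob_space "uniform_measure M A'"
    by (rule prob_space_uniform_measure) (use False eq in auto)
  obtain Z where Z[measurable]: "Z \<in> borel_measurable M" "\<And>z::real. prob (Z -` {z} \<inter> space M) = 0"
    using atomless by blast
  have "measure (uniform_measure M A) (Z -` {z} \<inter> space M) = 0" for z
  proof -
    have "prob (A \<inter> (Z -` {z} \<inter> space M)) \<le> prob (Z -` {z} \<inter> space M)"
      by (rule finite_measure_mono) auto
    then have "prob (A \<inter> (Z -` {z} \<inter> space M)) = 0" using Z(2)[of z] measure_nonneg by (metis order.antisym)
    then show ?thesis using False by (subst measure_uniform_measure) auto
  qed
  moreover have "prob_space (distr (uniform_measure M A') borel Y')"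
    by (rule N'.prob_space_distr) simp
  ultimately obtain Y where Y: "Y \<in> borel_measurable (uniform_measure M A)"
    and d: "distr (uniform_measure M A) borel Y = distr (uniform_measure M A') borel Y'"
    using N.exists_distr[of Z "distr (uniform_measure M A') borel Y'"] by auto
  have [measurable]: "Y \<in> borel_measurable M" using Y by simp
  show ?thesis
  proof (intro bexI[of _ Y] ballI)
    fix B :: "'b set" assume B[measurable]: "B \<in> sets borel"
    have A: "A \<inter> (Y -` B \<inter> space M) = A \<inter> Y -` B" and A': "A' \<inter> (Y' -` B \<inter> space M) = A' \<inter> Y' -` B"
      using sets.sets_into_space[of A M] sets.sets_into_space[of A' M] by auto
    have "measure (distr (uniform_measure M A) borel Y) B = prob (A \<inter> Y -` B) / prob A"
      using False by (simp add: measure_distr A)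
    moreover have "measure (distr (uniform_measure M A') borel Y') B = prob (A' \<inter> Y' -` B) / prob A'"
      using False eq by (simp add: measure_distr A')
    moreover have "prob A' = prob A" "prob A \<noteq> 0"
      using eq False by (simp_all add: emeasure_eq_measure)
    ultimately have "prob (A \<inter> Y -` B) = prob (A' \<inter> Y' -` B)" using d by simp
    then show "emeasure M (A \<inter> Y -` B) = emeasure M (A' \<inter> Y' -` B)"
      by (simp add: emeasure_eq_measure)
  qed simp
qed

text \<open>On the cell where \<open>K q = k\<close> the first component is the constant
  \<open>a k\<close>, so a joint event reduces to its slice at \<open>a k\<close>; the variables
  from \<open>rearrange_on_event\<close> are chosen independently on the cells and glued. Cells are
  indexed by \<open>k\<close>, not by \<open>a k\<close>, so \<open>a\<close> may repeat
  values.\<close>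

lemma rearrange_countable:
  fixes Y' :: "'a \<Rightarrow> 'b::{complete_space, second_countable_topology}"
    and a :: "nat \<Rightarrow> 'c::second_countable_topology"
  assumes K[measurable]: "K \<in> M \<rightarrow>\<^sub>M count_space UNIV" "K' \<in> M \<rightarrow>\<^sub>M count_space UNIV"
    and Y'[measurable]: "Y' \<in> borel_measurable M"
    and eq: "\<And>k. emeasure M (K -` {k} \<inter> space M) = emeasure M (K' -` {k} \<inter> space M)"
  obtains Y where "Y \<in> borel_measurable M"
    "distr M borel (\<lambda>q. (a (K q), Y q)) = distr M borel (\<lambda>q. (a (K' q), Y' q))"
proof -
  let ?A = "\<lambda>k. K -` {k} \<inter> space M" and ?A' = "\<lambda>k. K' -` {k} \<inter> space M"
  have "\<forall>k. \<exists>Y\<in>borel_measurable M. \<forall>B\<in>sets borel.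
      emeasure M (?A k \<inter> Y -` B) = emeasure M (?A' k \<inter> Y' -` B)"
    by (intro allI rearrange_on_event eq) simp_all
  then obtain y where y[measurable]: "\<And>k. y k \<in> borel_measurable M"
    and eqy: "\<And>k B. B \<in> sets borel \<Longrightarrow> emeasure M (?A k \<inter> y k -` B) = emeasure M (?A' k \<inter> Y' -` B)"
    by metis
  define Y where "Y q = y (K q) q" for q
  have [measurable]: "Y \<in> borel_measurable M"
    unfolding Y_def by (rule measurable_compose_countable[of "\<lambda>k q. y k q"]) auto
  have [measurable]: "(\<lambda>q. a (K q)) \<in> borel_measurable M" "(\<lambda>q. a (K' q)) \<in> borel_measurable M"
    by (rule measurable_compose[OF K(1)], simp) (rule measurable_compose[OF K(2)], simp)
  have [measurable]: "(\<lambda>q. (a (K q), Y q)) \<in> borel_measurable M"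
      "(\<lambda>q. (a (K' q), Y' q)) \<in> borel_measurable M"
    by (auto intro!: borel_measurable_Pair)
  have split: "emeasure M (h -` S \<inter> space M) = (\<Sum>k. emeasure M (L -` {k} \<inter> space M \<inter> h -` S))"
    if [measurable]: "h \<in> borel_measurable M" "L \<in> M \<rightarrow>\<^sub>M count_space UNIV" "S \<in> sets borel"
    for h :: "'a \<Rightarrow> 'c \<times> 'b" and S and L :: "'a \<Rightarrow> nat"
  proof -
    have "h -` S \<inter> space M = (\<Union>k. L -` {k} \<inter> space M \<inter> h -` S)" by auto
    also have "emeasure M \<dots> = (\<Sum>k. emeasure M (L -` {k} \<inter> space M \<inter> h -` S))"
    proof (rule suminf_emeasure[symmetric])
      have "L -` {k} \<inter> space M \<inter> h -` S = (L -` {k} \<inter> space M) \<inter> (h -` S \<inter> space M)" for k by auto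
      then show "range (\<lambda>k. L -` {k} \<inter> space M \<inter> h -` S) \<subseteq> events" by auto
    qed (auto simp: disjoint_family_on_def)
    finally show ?thesis .
  qed
  have "distr M borel (\<lambda>q. (a (K q), Y q)) = distr M borel (\<lambda>q. (a (K' q), Y' q))"
  proof (rule measure_eqI)
    fix S :: "('c \<times> 'b) set" assume "S \<in> sets (distr M borel (\<lambda>q. (a (K q), Y q)))"
    then have S[measurable]: "S \<in> sets borel" by simp
    have sect: "Pair (a k) -` S \<in> sets borel" for k
      using measurable_sets[of "Pair (a k)" borel borel S]
      by (simp add: borel_measurable_continuous_onI continuous_intros)
    have "emeasure M (?A k \<inter> (\<lambda>q. (a (K q), Y q)) -` S) = emeasure M (?A' k \<inter> (\<lambda>q. (a (K' q), Y' q)) -` S)" for k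
    proof -
      have "?A k \<inter> (\<lambda>q. (a (K q), Y q)) -` S = ?A k \<inter> y k -` (Pair (a k) -` S)"
        by (auto simp: Y_def)
      moreover have "?A' k \<inter> (\<lambda>q. (a (K' q), Y' q)) -` S = ?A' k \<inter> Y' -` (Pair (a k) -` S)"
        by auto
      ultimately show ?thesis using eqy[OF sect] by simp
    qed
    then show "emeasure (distr M borel (\<lambda>q. (a (K q), Y q))) S = emeasure (distr M borel (\<lambda>q. (a (K' q), Y' q))) S"
      using split[of "\<lambda>q. (a (K q), Y q)" K S] split[of "\<lambda>q. (a (K' q), Y' q)" K' S]
      by (simp add: emeasure_distr)
  qed simp
  then show thesis by (intro that[of Y]) simp_all
qed

lemma realize:
  fixes \<rho> :: "'b::{complete_space, second_countable_topology} measure"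
  assumes "prob_space \<rho>" "sets \<rho> = sets borel"
  obtains Y where "Y \<in> borel_measurable M" "distr M borel Y = \<rho>"
proof -
  obtain Z where "Z \<in> borel_measurable M" "\<And>z::real. prob (Z -` {z} \<inter> space M) = 0"
    using atomless by blast
  then show thesis by (rule exists_distr[OF _ _ assms]) (rule that)
qed

end

section \<open>The Hilbert space of square-integrable functions\<close>

definition L2_inner :: "'q measure \<Rightarrow> ('q \<Rightarrow> 'h::real_inner) \<Rightarrow> ('q \<Rightarrow> 'h) \<Rightarrow> real" where
  "L2_inner M X Y = (\<integral>q. X q \<bullet> Y q \<partial>M)"

text \<open>Without the square root, the Hilbert space identities below are integrated pointwise
  identities; \<open>L2_sqdist_weak_triangle\<close> stands in for the triangle inequality.\<close>

definition L2_sqdist :: "'q measure \<Rightarrow> ('q \<Rightarrow> 'h::real_normed_vector) \<Rightarrow> ('q \<Rightarrow> 'h) \<Rightarrow> real" where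
  "L2_sqdist M X Y = (\<integral>q. (norm (X q - Y q))\<^sup>2 \<partial>M)"

lemma L2_space_measurable [measurable_dest]: "X \<in> L2_space M \<Longrightarrow> X \<in> borel_measurable M"
  by (simp add: L2_space_def)

lemma L2_space_integrable: "X \<in> L2_space M \<Longrightarrow> integrable M (\<lambda>q. (norm (X q))\<^sup>2)"
  by (simp add: L2_space_def)

lemma L2_spaceI_bound:
  assumes [measurable]: "X \<in> borel_measurable M" and "integrable M f" "\<And>q. (norm (X q))\<^sup>2 \<le> f q"
  shows "X \<in> L2_space M"
proof -
  have "integrable M (\<lambda>q. (norm (X q))\<^sup>2)"
    by (rule Bochner_Integration.integrable_bound[OF assms(2)])
       (auto intro!: AE_I2 order.trans[OF assms(3) abs_ge_self])
  then show ?thesis by (simp add: L2_space_def)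
qed

lemma norm_diff_sq_le: "(norm (x - y :: 'a::real_inner))\<^sup>2 \<le> 2 * (norm x)\<^sup>2 + 2 * (norm y)\<^sup>2"
  using zero_le_power2[of "norm (x + y)"]
  by (simp add: power2_norm_eq_inner inner_diff inner_add inner_commute algebra_simps)

lemma L2_space_diff:
  assumes "X \<in> L2_space M" "Y \<in> L2_space M"
  shows "(\<lambda>q. X q - Y q) \<in> L2_space M"
proof (rule L2_spaceI_bound)
  show "integrable M (\<lambda>q. 2 * (norm (X q))\<^sup>2 + 2 * (norm (Y q))\<^sup>2)"
    using assms[THEN L2_space_integrable] by simp
qed (use assms in \<open>auto intro: norm_diff_sq_le\<close>)

lemma L2_space_scaleR:
  assumes "X \<in> L2_space M" shows "(\<lambda>q. c *\<^sub>R X q) \<in> L2_space M"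
proof (rule L2_spaceI_bound)
  show "integrable M (\<lambda>q. c\<^sup>2 * (norm (X q))\<^sup>2)"
    using L2_space_integrable[OF assms] by simp
qed (use assms in \<open>auto simp: power_mult_distrib\<close>)

lemma L2_space_lincomb:
  assumes "X \<in> L2_space M" "Y \<in> L2_space M"
  shows "(\<lambda>q. a *\<^sub>R X q + b *\<^sub>R Y q) \<in> L2_space M"
  using L2_space_diff[OF L2_space_scaleR[OF assms(1), of a] L2_space_scaleR[OF assms(2), of "-b"]] by simp

lemma L2_inner_integrable:
  assumes "X \<in> L2_space M" "Y \<in> L2_space M"
  shows "integrable M (\<lambda>q. X q \<bullet> Y q)"
proof (rule Bochner_Integration.integrable_bound)
  show "integrable M (\<lambda>q. (norm (X q))\<^sup>2 + (norm (Y q))\<^sup>2)"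
    using assms[THEN L2_space_integrable] by simp
  have "\<bar>x \<bullet> y\<bar> \<le> (norm x)\<^sup>2 + (norm y)\<^sup>2" for x y :: 'b
  proof -
    have "\<bar>x \<bullet> y\<bar> \<le> norm x * norm y" by (rule Cauchy_Schwarz_ineq2)
    moreover have "0 \<le> (norm x - norm y)\<^sup>2" "0 \<le> (norm x)\<^sup>2" "0 \<le> (norm y)\<^sup>2" by simp_all
    ultimately show ?thesis by (simp add: power2_diff)
  qed
  then show "AE q in M. norm (X q \<bullet> Y q) \<le> norm ((norm (X q))\<^sup>2 + (norm (Y q))\<^sup>2)"
    by (auto intro!: order.trans[OF _ abs_ge_self])
qed (use assms in measurable)

lemma L2_sqdist_integrable:
  assumes "X \<in> L2_space M" "Y \<in> L2_space M"
  shows "integrable M (\<lambda>q. (norm (X q - Y q))\<^sup>2)"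
  by (rule L2_space_integrable[OF L2_space_diff[OF assms]])

lemma L2_inner_commute: "L2_inner M X Y = L2_inner M Y X"
  by (simp add: L2_inner_def inner_commute)

lemma L2_inner_lincomb_left:
  assumes "X \<in> L2_space M" "Y \<in> L2_space M" "Z \<in> L2_space M"
  shows "L2_inner M (\<lambda>q. a *\<^sub>R X q + b *\<^sub>R Y q) Z = a * L2_inner M X Z + b * L2_inner M Y Z"
  using assms by (simp add: L2_inner_def inner_add_left L2_inner_integrable)

lemma L2_inner_diff_left:
  assumes "X \<in> L2_space M" "Y \<in> L2_space M" "Z \<in> L2_space M"
  shows "L2_inner M (\<lambda>q. X q - Y q) Z = L2_inner M X Z - L2_inner M Y Z"
  using L2_inner_lincomb_left[OF assms, of 1 "-1"] by simp

lemma L2_inner_scaleR_right: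
  "X \<in> L2_space M \<Longrightarrow> Y \<in> L2_space M \<Longrightarrow> L2_inner M X (\<lambda>q. c *\<^sub>R Y q) = c * L2_inner M X Y"
  by (simp add: L2_inner_def)

lemma L2_distance_eq: "L2_distance M X Y = sqrt (L2_sqdist M X Y)"
  by (simp add: L2_distance_def L2_sqdist_def)

lemma L2_sqdist_nonneg: "0 \<le> L2_sqdist M X Y"
  by (simp add: L2_sqdist_def)

lemma L2_sqdist_commute: "L2_sqdist M X Y = L2_sqdist M Y X"
  by (simp add: L2_sqdist_def norm_minus_commute)

text \<open>A pointwise quadratic identity, integrated. The negative last term is the strict
  convexity that makes minimizing sequences Cauchy and yields the variational inequality at a
  minimizer.\<close>

lemma L2_sqdist_convex_comb:
  assumes "X \<in> L2_space M" "Y \<in> L2_space M" "Z \<in> L2_space M"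
  shows "L2_sqdist M (\<lambda>q. (1 - t) *\<^sub>R X q + t *\<^sub>R Y q) Z =
    (1 - t) * L2_sqdist M X Z + t * L2_sqdist M Y Z - t * (1 - t) * L2_sqdist M X Y"
proof -
  have "(norm ((1 - t) *\<^sub>R x + t *\<^sub>R y - z))\<^sup>2 =
      (1 - t) * (norm (x - z))\<^sup>2 + t * (norm (y - z))\<^sup>2 - t * (1 - t) * (norm (x - y))\<^sup>2"
    for x y z :: 'b
    by (simp add: power2_norm_eq_inner inner_diff inner_add inner_commute algebra_simps)
  then show ?thesis
    using assms by (simp add: L2_sqdist_def L2_sqdist_integrable)
qed

text \<open>The law of cosines, arranged so that the variational inequality for squared distances
  becomes affine in \<open>X\<close>.\<close>

lemma L2_sqdist_polar:
  assumes "X \<in> L2_space M" "Y \<in> L2_space M" "Z \<in> L2_space M"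
  shows "L2_sqdist M X Z - L2_sqdist M Y Z - L2_sqdist M X Y =
    2 * (L2_inner M Y (\<lambda>q. Z q - Y q) - L2_inner M X (\<lambda>q. Z q - Y q))"
proof -
  have "(norm (x - z))\<^sup>2 = (norm (y - z))\<^sup>2 + (norm (x - y))\<^sup>2 + 2 * (y \<bullet> (z - y) - x \<bullet> (z - y))"
    for x y z :: 'b
    by (simp add: power2_norm_eq_inner inner_diff inner_add inner_commute algebra_simps)
  then have "L2_sqdist M X Z = (\<integral>q. (norm (Y q - Z q))\<^sup>2 + (norm (X q - Y q))\<^sup>2 +
      2 * (Y q \<bullet> (Z q - Y q) - X q \<bullet> (Z q - Y q)) \<partial>M)"
    by (simp add: L2_sqdist_def)
  also have "\<dots> = L2_sqdist M Y Z + L2_sqdist M X Y +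
      2 * (L2_inner M Y (\<lambda>q. Z q - Y q) - L2_inner M X (\<lambda>q. Z q - Y q))"
    using assms by (simp add: L2_sqdist_def L2_inner_def L2_sqdist_integrable L2_inner_integrable L2_space_diff)
  finally show ?thesis by simp
qed

text \<open>The mixed term of the squared triangle inequality is split by Young's inequality with
  weight \<open>e\<close>. As the factor \<open>1 + e\<close> tends to 1, one can let
  \<open>L2_sqdist M X Y\<close> vanish first and \<open>e\<close> afterwards without loss.\<close>

lemma L2_sqdist_weak_triangle:
  assumes "X \<in> L2_space M" "Y \<in> L2_space M" "Z \<in> L2_space M" "0 < e"
  shows "L2_sqdist M X Z \<le> (1 + e) * L2_sqdist M Y Z + (1 + 1 / e) * L2_sqdist M X Y"
proof -
  have le: "(norm (x - z))\<^sup>2 \<le> (1 + e) * (norm (y - z))\<^sup>2 + (1 + 1 / e) * (norm (x - y))\<^sup>2"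
    for x y z :: 'b
  proof -
    let ?a = "norm (y - z)" and ?b = "norm (x - y)"
    have "norm (x - z) \<le> ?a + ?b" using norm_triangle_ineq[of "x - y" "y - z"] by simp
    then have "(norm (x - z))\<^sup>2 \<le> (?a + ?b)\<^sup>2" by (simp add: power_mono)
    moreover have "0 \<le> (e * ?a - ?b)\<^sup>2 / e" using \<open>0 < e\<close> by simp
    moreover have "(e * ?a - ?b)\<^sup>2 / e = e * ?a\<^sup>2 - 2 * ?a * ?b + ?b\<^sup>2 / e"
      using \<open>0 < e\<close> by (simp add: power2_eq_square field_simps)
    ultimately show ?thesis by (simp add: power2_sum algebra_simps)
  qed
  have "L2_sqdist M X Z \<le> (\<integral>q. (1 + e) * (norm (Y q - Z q))\<^sup>2 + (1 + 1 / e) * (norm (X q - Y q))\<^sup>2 \<partial>M)"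
    unfolding L2_sqdist_def using assms le
    by (intro integral_mono) (simp_all add: L2_sqdist_integrable)
  also have "\<dots> = (1 + e) * L2_sqdist M Y Z + (1 + 1 / e) * L2_sqdist M X Y"
    using assms by (simp add: L2_sqdist_def L2_sqdist_integrable)
  finally show ?thesis .
qed

section \<open>Completeness\<close>

text \<open>The Riesz-Fischer argument along a fast Cauchy sequence: the increments have summable
  expectations, hence the sequence converges almost everywhere, and Fatou's lemma carries the
  distance bounds over to the limit.\<close>

lemma (in prob_space) L2_complete:
  fixes X :: "nat \<Rightarrow> 'a \<Rightarrow> 'h::{real_inner, polish_space}"
  assumes X: "\<And>n. X n \<in> L2_space M"
    and fast: "\<And>m n. n \<le> m \<Longrightarrow> L2_sqdist M (X m) (X n) \<le> (1/4) ^ n"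
  obtains Y where "Y \<in> L2_space M" "\<And>n. L2_sqdist M Y (X n) \<le> (1/4) ^ n"
proof -
  note [measurable] = L2_space_measurable[OF X]
  have nn: "(\<integral>\<^sup>+q. (norm (X m q - X n q))\<^sup>2 \<partial>M) \<le> ennreal ((1/4) ^ n)" if "n \<le> m" for m n
    using fast[OF that] L2_sqdist_integrable[OF X X, of m n]
    by (simp add: nn_integral_eq_integral L2_sqdist_def ennreal_leI)
  let ?d = "\<lambda>n q. norm (X (Suc n) q - X n q)"
  have L1: "(\<integral>\<^sup>+q. ?d n q \<partial>M) \<le> ennreal ((1/2) ^ n)" for n
  proof -
    have int: "integrable M (\<lambda>q. 2 ^ n * (?d n q)\<^sup>2 / 2 + (1/2) ^ n / 2)"
      using L2_sqdist_integrable[OF X X, of "Suc n" n] by simp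
    \<comment> \<open>Expanding a square replaces Cauchy-Schwarz; the weight \<open>2 ^ n\<close>
      balances a second moment of order \<open>(1/4) ^ n\<close> against the constant, and each half
      is at most \<open>(1/2) ^ n / 2\<close>.\<close>
    have le: "x \<le> 2 ^ n * x\<^sup>2 / 2 + (1/2) ^ n / 2" for x :: real
    proof -
      have "0 \<le> (2 ^ n * x - 1)\<^sup>2 / (2 * 2 ^ n)" by simp
      also have "\<dots> = 2 ^ n * x\<^sup>2 / 2 + (1/2) ^ n / 2 - x"
        by (simp add: power2_eq_square field_simps power_one_over)
      finally show ?thesis by simp
    qed
    have "(\<integral>\<^sup>+q. ?d n q \<partial>M) \<le> (\<integral>\<^sup>+q. 2 ^ n * (?d n q)\<^sup>2 / 2 + (1/2) ^ n / 2 \<partial>M)"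
      by (intro nn_integral_mono ennreal_leI le)
    also have "\<dots> = ennreal (2 ^ n * L2_sqdist M (X (Suc n)) (X n) / 2 + (1/2) ^ n / 2)"
      using L2_sqdist_integrable[OF X X, of "Suc n" n]
      by (subst nn_integral_eq_integral[OF int]) (simp_all add: L2_sqdist_def prob_space)
    also have "\<dots> \<le> ennreal ((1/2) ^ n)"
    proof (rule ennreal_leI)
      have "2 ^ n * L2_sqdist M (X (Suc n)) (X n) \<le> 2 ^ n * (1/4) ^ n"
        by (intro mult_left_mono fast) auto
      also have "\<dots> = (1/2) ^ n" by (simp flip: power_mult_distrib)
      finally show "2 ^ n * L2_sqdist M (X (Suc n)) (X n) / 2 + (1/2) ^ n / 2 \<le> (1/2) ^ n" by simp
    qed
    finally show ?thesis .
  qed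
  have "(\<integral>\<^sup>+q. (\<Sum>n. ennreal (?d n q)) \<partial>M) = (\<Sum>n. \<integral>\<^sup>+q. ?d n q \<partial>M)"
    by (rule nn_integral_suminf) simp
  also have "\<dots> \<le> (\<Sum>n. ennreal ((1/2) ^ n))"
    by (intro suminf_le L1) auto
  also have "\<dots> = ennreal 2"
    by (rule suminf_ennreal_eq) (use geometric_sums[of "1/2::real"] in auto)
  finally have "(\<integral>\<^sup>+q. (\<Sum>n. ennreal (?d n q)) \<partial>M) \<noteq> \<infinity>" by (auto simp: top_unique)
  then have "AE q in M. (\<Sum>n. ennreal (?d n q)) \<noteq> \<infinity>"
    by (intro nn_integral_PInf_AE) auto
  then have cau: "AE q in M. Cauchy (\<lambda>n. X n q)"
  proof (rule AE_mp, intro AE_I2 impI)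
    fix q assume "(\<Sum>n. ennreal (?d n q)) \<noteq> \<infinity>"
    then have sm: "summable (\<lambda>n. ?d n q)"
      by (intro summable_suminf_not_top) auto
    show "Cauchy (\<lambda>n. X n q)"
    proof (rule metric_CauchyI)
      fix e :: real assume "0 < e"
      then obtain N where N: "\<And>m n. N \<le> m \<Longrightarrow> norm (sum (\<lambda>n. ?d n q) {m..<n}) < e"
        using sm unfolding summable_Cauchy by blast
      have bd: "dist (X m q) (X n q) < e" if "N \<le> m" "m \<le> n" for m n
      proof -
        have "norm (X n q - X m q) = norm (\<Sum>k=m..<n. X (Suc k) q - X k q)"
          by (subst sum_Suc_diff'[OF that(2), of "\<lambda>k. X k q"]) (rule refl)
        also have "\<dots> \<le> (\<Sum>k=m..<n. ?d k q)" by (rule norm_sum)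
        also have "\<dots> < e" using N[OF that(1), of n] by simp
        finally show ?thesis by (simp add: dist_norm norm_minus_commute)
      qed
      show "\<exists>N. \<forall>m\<ge>N. \<forall>n\<ge>N. dist (X m q) (X n q) < e"
        by (intro exI[of _ N] allI impI) (metis bd dist_commute le_cases)
    qed
  qed
  \<comment> \<open>Convergence holds only almost everywhere. The default 0 makes \<open>Z\<close>
    converge at every point, so its limit is measurable; it changes \<open>X\<close> only on a null
    set.\<close>
  define Z where "Z n q = (if Cauchy (\<lambda>n. X n q) then X n q else 0)" for n q
  define Y where "Y q = lim (\<lambda>n. Z n q)" for q
  have Z[measurable]: "Z n \<in> borel_measurable M" for n unfolding Z_def by measurable
  have lim: "(\<lambda>n. Z n q) \<longlonglongrightarrow> Y q" for q
    unfolding Y_def convergent_LIMSEQ_iff[symmetric]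
  proof (cases "Cauchy (\<lambda>n. X n q)")
    case True
    then show "convergent (\<lambda>n. Z n q)" using Cauchy_convergent[OF True] by (simp add: Z_def)
  next
    case False
    then show "convergent (\<lambda>n. Z n q)" by (simp add: Z_def convergent_const)
  qed
  have Y[measurable]: "Y \<in> borel_measurable M"
    by (rule borel_measurable_LIMSEQ_metric[of Z], rule Z, rule lim)
  have lim_AE: "AE q in M. (\<lambda>n. X n q) \<longlonglongrightarrow> Y q"
    using cau
  proof (rule AE_mp, intro AE_I2 impI)
    fix q assume "Cauchy (\<lambda>n. X n q)"
    then have "Z n q = X n q" for n by (simp add: Z_def)
    then show "(\<lambda>n. X n q) \<longlonglongrightarrow> Y q" using lim[of q] by simp
  qed
  have bound: "(\<integral>\<^sup>+q. (norm (Y q - X n q))\<^sup>2 \<partial>M) \<le> ennreal ((1/4) ^ n)" for n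
  proof -
    have "(\<integral>\<^sup>+q. (norm (Y q - X n q))\<^sup>2 \<partial>M) = (\<integral>\<^sup>+q. liminf (\<lambda>m. ennreal ((norm (X m q - X n q))\<^sup>2)) \<partial>M)"
    proof (rule nn_integral_cong_AE, use lim_AE in \<open>rule AE_mp\<close>, intro AE_I2 impI)
      fix q assume "(\<lambda>n. X n q) \<longlonglongrightarrow> Y q"
      then have "(\<lambda>m. ennreal ((norm (X m q - X n q))\<^sup>2)) \<longlonglongrightarrow> ennreal ((norm (Y q - X n q))\<^sup>2)"
        by (intro tendsto_intros) auto
      then show "ennreal ((norm (Y q - X n q))\<^sup>2) = liminf (\<lambda>m. ennreal ((norm (X m q - X n q))\<^sup>2))"
        by (intro lim_imp_Liminf[symmetric]) auto
    qed
    also have "\<dots> \<le> liminf (\<lambda>m. \<integral>\<^sup>+q. (norm (X m q - X n q))\<^sup>2 \<partial>M)"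
      by (rule nn_integral_liminf) simp
    also have "\<dots> \<le> ennreal ((1/4) ^ n)"
      by (rule Liminf_le[OF _ eventually_mono[OF eventually_ge_at_top[of n]]]) (simp_all add: nn)
    finally show ?thesis .
  qed
  have fin: "integrable M (\<lambda>q. (norm (Y q - X n q))\<^sup>2)" for n
    using bound[of n] by (intro integrableI_bounded) (auto simp: le_less_trans)
  have "(\<lambda>q. Y q - X 0 q) \<in> L2_space M" using fin[of 0] by (simp add: L2_space_def)
  from L2_space_lincomb[OF this X[of 0], of 1 1] have "Y \<in> L2_space M" by simp
  moreover have "L2_sqdist M Y (X n) \<le> (1/4) ^ n" for n
    using bound[of n] by (simp add: nn_integral_eq_integral[OF fin] L2_sqdist_def)
  ultimately show thesis using that by blast
qed


section \<open>Projection onto the epigraph and affine minorants\<close>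

lemma lsc_on_L2_le:
  assumes lsc: "lsc_on (L2_space M) (L2_distance M) F"
    and X: "\<And>n. X n \<in> L2_space M" and Y: "Y \<in> L2_space M"
    and conv: "(\<lambda>n. L2_sqdist M Y (X n)) \<longlonglongrightarrow> 0"
    and r: "r \<longlonglongrightarrow> s" and le: "\<And>n. F (X n) \<le> ereal (r n)"
  shows "F Y \<le> ereal s"
proof (rule ccontr)
  assume "\<not> F Y \<le> ereal s"
  then have "ereal s < F Y" by simp
  then obtain c where c: "ereal s < c" "c < F Y" using dense by blast
  then obtain d where d: "d > 0" "\<And>Z. Z \<in> L2_space M \<Longrightarrow> L2_distance M Y Z < d \<Longrightarrow> c < F Z"
    using lsc Y unfolding lsc_on_def by blast
  have "(\<lambda>n. L2_distance M Y (X n)) \<longlonglongrightarrow> sqrt 0"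
    unfolding L2_distance_eq by (intro tendsto_intros conv)
  then have "eventually (\<lambda>n. L2_distance M Y (X n) < d) sequentially"
    using d(1) by (auto dest: order_tendstoD(2))
  moreover have "eventually (\<lambda>n. ereal (r n) < c) sequentially"
    using tendsto_ereal[OF r] c(1) by (rule order_tendstoD(2))
  ultimately have "eventually (\<lambda>n. c < F (X n) \<and> ereal (r n) < c) sequentially"
    by eventually_elim (use d(2) X in auto)
  then obtain n where "c < F (X n)" "ereal (r n) < c" by (auto dest: eventually_happens)
  then show False using le[of n] by (auto dest: order.strict_trans1 simp: not_less)
qed

text \<open>This is the Hilbert projection of \<open>(X0, c)\<close> onto the epigraph, which is
  convex and sequentially closed. The conclusion says that \<open>(X0 - Y, c - s)\<close> is an
  outward normal at the projection \<open>(Y, s)\<close>, with the real coordinate moved to the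
  right-hand side.\<close>

lemma (in prob_space) epigraph_projection:
  fixes F :: "('a \<Rightarrow> 'h::{real_inner, polish_space}) \<Rightarrow> ereal"
  assumes cvx: "convex_L2 M F" and lsc: "lsc_on (L2_space M) (L2_distance M) F"
    and ne: "U \<in> L2_space M" "F U \<le> ereal u" and X0: "X0 \<in> L2_space M"
  obtains Y s where "Y \<in> L2_space M" "F Y \<le> ereal s"
    "\<And>X r. X \<in> L2_space M \<Longrightarrow> F X \<le> ereal r \<Longrightarrow>
      L2_inner M X (\<lambda>q. X0 q - Y q) - L2_inner M Y (\<lambda>q. X0 q - Y q) \<le> (s - c) * (r - s)"
proof -
  define C where "C = {(X, r). X \<in> L2_space M \<and> F X \<le> ereal r}"
  define J where "J = (\<lambda>(X, r). L2_sqdist M X X0 + (r - c)\<^sup>2)"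
  define d where "d = Inf (J ` C)"
  have "(U, u) \<in> C" using ne by (simp add: C_def)
  have J0: "0 \<le> J x" for x by (auto simp: J_def L2_sqdist_nonneg split: prod.split)
  have bdd: "bdd_below (J ` C)" by (rule bdd_belowI[of _ 0]) (auto simp: J0)
  have dle: "d \<le> J x" if "x \<in> C" for x unfolding d_def by (rule cInf_lower[OF _ bdd]) (use that in auto)
  have d0: "0 \<le> d" unfolding d_def
    by (rule cInf_greatest) (use \<open>(U, u) \<in> C\<close> J0 in auto)
  have comb: "((\<lambda>q. (1 - t) *\<^sub>R X q + t *\<^sub>R Z q), (1 - t) * r + t * s) \<in> C"
    if "(X, r) \<in> C" "(Z, s) \<in> C" "0 \<le> t" "t \<le> 1" for X Z r s t
  proof -
    have XZ: "X \<in> L2_space M" "F X \<le> ereal r" "Z \<in> L2_space M" "F Z \<le> ereal s"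
      using that by (auto simp: C_def)
    have "F (\<lambda>q. (1 - t) *\<^sub>R X q + t *\<^sub>R Z q) \<le> ereal (1 - t) * F X + ereal t * F Z"
      using cvx XZ that unfolding convex_L2_def by auto
    also have "\<dots> \<le> ereal (1 - t) * ereal r + ereal t * ereal s"
      using XZ that by (intro add_mono ereal_mult_left_mono) auto
    finally show ?thesis using XZ by (simp add: C_def L2_space_lincomb)
  qed
  have Jcomb: "J ((\<lambda>q. (1 - t) *\<^sub>R X q + t *\<^sub>R Z q), (1 - t) * r + t * s) =
      (1 - t) * J (X, r) + t * J (Z, s) - t * (1 - t) * (L2_sqdist M X Z + (r - s)\<^sup>2)"
    if "(X, r) \<in> C" "(Z, s) \<in> C" for X Z r s t
  proof -
    have "X \<in> L2_space M" "Z \<in> L2_space M" using that by (auto simp: C_def)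
    then have eq: "L2_sqdist M (\<lambda>q. (1 - t) *\<^sub>R X q + t *\<^sub>R Z q) X0 =
        (1 - t) * L2_sqdist M X X0 + t * L2_sqdist M Z X0 - t * (1 - t) * L2_sqdist M X Z"
      by (rule L2_sqdist_convex_comb[OF _ _ X0])
    show ?thesis
      unfolding J_def prod.case eq by (simp add: power2_eq_square algebra_simps)
  qed
  \<comment> \<open>With this tolerance, comparison at the midpoint bounds the squared distance of
    two members by the mean of \<open>(1/4) ^ m\<close> and \<open>(1/4) ^ n\<close>, hence by
    \<open>(1/4) ^ n\<close>, the rate that \<open>L2_complete\<close> asks for.\<close>
  have "\<exists>x\<in>C. J x < d + (1/4) ^ n / 4" for n
  proof -
    have "Inf (J ` C) < d + (1/4) ^ n / 4" by (simp add: d_def)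
    then show ?thesis using \<open>(U, u) \<in> C\<close> by (subst (asm) cInf_less_iff[OF _ bdd]) auto
  qed
  then obtain x where x: "\<And>n. x n \<in> C" "\<And>n. J (x n) < d + (1/4) ^ n / 4" by metis
  define X where "X n = fst (x n)" for n
  define r where "r n = snd (x n)" for n
  have Xr: "(X n, r n) \<in> C" "J (X n, r n) < d + (1/4) ^ n / 4" for n
    using x by (simp_all add: X_def r_def)
  have XL: "X n \<in> L2_space M" for n using Xr(1)[of n] by (simp add: C_def)
  have close: "L2_sqdist M (X m) (X n) + (r m - r n)\<^sup>2 \<le> (1/4) ^ n" if "n \<le> m" for m n
  proof -
    have "d \<le> (1 - 1/2) * J (X m, r m) + 1/2 * J (X n, r n)
        - 1/2 * (1 - 1/2) * (L2_sqdist M (X m) (X n) + (r m - r n)\<^sup>2)"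
      using dle[OF comb[OF Xr(1)[of m] Xr(1)[of n], of "1/2"]]
      unfolding Jcomb[OF Xr(1)[of m] Xr(1)[of n]] by simp
    moreover have "(1/4::real) ^ m \<le> (1/4) ^ n" using that by (intro power_decreasing) auto
    moreover have "S \<le> q"
      if "d \<le> (1 - 1/2) * A + 1/2 * B - 1/2 * (1 - 1/2) * S" "p \<le> q" "A < d + p / 4" "B < d + q / 4"
      for S p q A B :: real
      using that by (simp add: field_simps)
    ultimately show ?thesis using Xr(2)[of m] Xr(2)[of n] by blast
  qed
  have "L2_sqdist M (X m) (X n) \<le> (1/4) ^ n" if "n \<le> m" for m n
    using close[OF that] zero_le_power2[of "r m - r n"] by linarith
  then obtain Y where Y: "Y \<in> L2_space M" "\<And>n. L2_sqdist M Y (X n) \<le> (1/4) ^ n"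
    using L2_complete[of X] XL by metis
  have rle: "\<bar>r m - r n\<bar> \<le> (1/2) ^ n" if "n \<le> m" for m n
  proof -
    have "\<bar>r m - r n\<bar>\<^sup>2 \<le> ((1/2) ^ n)\<^sup>2"
      using close[OF that] L2_sqdist_nonneg[of M "X m" "X n"]
      by (simp add: power_mult[symmetric] mult.commute[of n] power_mult power_one_over)
    then show ?thesis by (rule power2_le_imp_le) simp
  qed
  have half: "(\<lambda>n. (1/2::real) ^ n) \<longlonglongrightarrow> 0" "(\<lambda>n. (1/4::real) ^ n) \<longlonglongrightarrow> 0"
    by (simp_all add: LIMSEQ_realpow_zero)
  have "Cauchy r"
  proof (rule metric_CauchyI)
    fix e :: real assume "0 < e"
    then obtain N where N: "(1/2::real) ^ N < e"
      using real_arch_pow_inv[of e "1/2"] by auto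
    have bd: "dist (r m) (r n) < e" if "N \<le> n" "n \<le> m" for m n
    proof -
      have "dist (r m) (r n) \<le> (1/2) ^ n" using rle[OF that(2)] by (simp add: dist_real_def)
      also have "\<dots> \<le> (1/2) ^ N" by (rule power_decreasing) (use that in auto)
      also have "\<dots> < e" by (rule N)
      finally show ?thesis .
    qed
    show "\<exists>N. \<forall>m\<ge>N. \<forall>n\<ge>N. dist (r m) (r n) < e"
      by (intro exI[of _ N] allI impI) (metis bd dist_commute le_cases)
  qed
  then obtain s where s: "r \<longlonglongrightarrow> s" using Cauchy_convergent convergent_def by blast
  have lim0: "(\<lambda>n. L2_sqdist M Y (X n)) \<longlonglongrightarrow> 0"
    by (rule tendsto_sandwich[OF _ _ tendsto_const half(2)]) (auto simp: Y L2_sqdist_nonneg)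
  have FY: "F Y \<le> ereal s"
    by (rule lsc_on_L2_le[OF lsc XL Y(1) lim0 s]) (use Xr(1) in \<open>simp add: C_def\<close>)
  have YC: "(Y, s) \<in> C" using Y FY by (simp add: C_def)
  have JY: "J (Y, s) \<le> d"
  proof -
    \<comment> \<open>The limit in \<open>n\<close> is taken at fixed \<open>e\<close>, through the
      weak triangle inequality between \<open>Y\<close>, \<open>X n\<close> and \<open>X0\<close>;
      \<open>e\<close> tends to 0 afterwards.\<close>
    have JYe: "J (Y, s) \<le> d + e * d" if e: "0 < e" for e
    proof -
      have "J (Y, s) \<le> (1 + e) * (d + 0 / 4 - (s - c)\<^sup>2) + (1 + 1/e) * 0 + (s - c)\<^sup>2"
      proof (rule tendsto_le[OF sequentially_bot _ tendsto_const])
      show "(\<lambda>n. (1 + e) * (d + (1/4) ^ n / 4 - (r n - c)\<^sup>2) + (1 + 1/e) * L2_sqdist M Y (X n) + (s - c)\<^sup>2)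
          \<longlonglongrightarrow> (1 + e) * (d + 0 / 4 - (s - c)\<^sup>2) + (1 + 1/e) * 0 + (s - c)\<^sup>2"
        by (intro tendsto_intros half lim0 s) simp_all
      have "L2_sqdist M Y X0 \<le> (1 + e) * (d + (1/4) ^ n / 4 - (r n - c)\<^sup>2) + (1 + 1/e) * L2_sqdist M Y (X n)" for n
      proof -
        have "(1 + e) * L2_sqdist M (X n) X0 \<le> (1 + e) * (d + (1/4) ^ n / 4 - (r n - c)\<^sup>2)"
          using Xr(2)[of n] e by (intro mult_left_mono) (auto simp: J_def)
        then show ?thesis using L2_sqdist_weak_triangle[OF Y(1) XL X0 e, of n] by linarith
      qed
      then show "\<forall>\<^sub>F n in sequentially. J (Y, s) \<le>
          (1 + e) * (d + (1/4) ^ n / 4 - (r n - c)\<^sup>2) + (1 + 1/e) * L2_sqdist M Y (X n) + (s - c)\<^sup>2"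
        by (simp add: J_def)
      qed
      also have "\<dots> \<le> d + e * d" using e by (simp add: algebra_simps)
      finally show ?thesis .
    qed
    show ?thesis
    proof (rule field_le_epsilon)
      fix e :: real assume "0 < e"
      moreover have "e / (d + 1) * d \<le> e" using d0 \<open>0 < e\<close> by (simp add: field_simps)
      ultimately show "J (Y, s) \<le> d + e" using JYe[of "e / (d + 1)"] d0 by simp
    qed
  qed
  \<comment> \<open>Minimality along the segment from \<open>(Y, s)\<close> to
    \<open>(X, r)\<close>, divided by \<open>t\<close>, leaves the factor \<open>1 - t\<close> on
    the quadratic term; letting \<open>t\<close> tend to 0 makes it 1.\<close>
  have var: "J (Y, s) + L2_sqdist M X Y + (r - s)\<^sup>2 \<le> J (X, r)" if "(X, r) \<in> C" for X r
  proof -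
    have "J (Y, s) + (1 - t) * (L2_sqdist M X Y + (r - s)\<^sup>2) \<le> J (X, r)" if t: "0 < t" "t < 1" for t
    proof -
      have "J (Y, s) \<le> J ((\<lambda>q. (1 - t) *\<^sub>R Y q + t *\<^sub>R X q), (1 - t) * s + t * r)"
        using JY dle[OF comb[OF YC \<open>(X, r) \<in> C\<close>, of t]] t by simp
      also have "\<dots> = (1 - t) * J (Y, s) + t * J (X, r) - t * (1 - t) * (L2_sqdist M X Y + (r - s)\<^sup>2)"
        unfolding Jcomb[OF YC \<open>(X, r) \<in> C\<close>] by (simp add: L2_sqdist_commute power2_commute)
      finally have "t * (J (Y, s) + (1 - t) * (L2_sqdist M X Y + (r - s)\<^sup>2)) \<le> t * J (X, r)"
        by (simp add: algebra_simps)
      then show ?thesis using t by simp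
    qed
    then have "eventually (\<lambda>t. J (Y, s) + (1 - t) * (L2_sqdist M X Y + (r - s)\<^sup>2) \<le> J (X, r)) (at_right 0)"
      by (intro eventually_at_rightI[of 0 1]) auto
    moreover have "((\<lambda>t. J (Y, s) + (1 - t) * (L2_sqdist M X Y + (r - s)\<^sup>2)) \<longlongrightarrow>
        J (Y, s) + (1 - 0) * (L2_sqdist M X Y + (r - s)\<^sup>2)) (at_right 0)"
      by (intro tendsto_intros)
    ultimately have "J (Y, s) + (1 - 0) * (L2_sqdist M X Y + (r - s)\<^sup>2) \<le> J (X, r)"
      by (intro tendsto_upperbound) auto
    then show ?thesis by simp
  qed
  show thesis
  proof (rule that[OF Y(1) FY])
    fix X r assume X: "X \<in> L2_space M" "F X \<le> ereal r"
    have "J (Y, s) + L2_sqdist M X Y + (r - s)\<^sup>2 \<le> J (X, r)"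
      by (rule var) (simp add: C_def X)
    with L2_sqdist_polar[OF X(1) Y(1) X0]
    show "L2_inner M X (\<lambda>q. X0 q - Y q) - L2_inner M Y (\<lambda>q. X0 q - Y q) \<le> (s - c) * (r - s)"
      by (simp add: J_def power2_eq_square algebra_simps)
  qed
qed


text \<open>A nonvertical supporting hyperplane, rescaled, is the minorant sought. A vertical one
  only separates \<open>X0\<close> from the domain of \<open>F\<close>; adding a large multiple
  \<open>k\<close> of it to any minorant does no harm on the domain and raises the value at
  \<open>X0\<close> above \<open>c\<close>.\<close>

lemma (in prob_space) affine_minorant:
  fixes F :: "('a \<Rightarrow> 'h::{real_inner, polish_space}) \<Rightarrow> ereal"
  assumes cvx: "convex_L2 M F" and lsc: "lsc_on (L2_space M) (L2_distance M) F"
    and fin: "\<And>X. X \<in> L2_space M \<Longrightarrow> F X \<noteq> -\<infinity>"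
    and U: "U \<in> L2_space M" "F U \<noteq> \<infinity>" and X0: "X0 \<in> L2_space M" "ereal c < F X0"
  obtains Y a where "Y \<in> L2_space M" "\<And>X. X \<in> L2_space M \<Longrightarrow> ereal (L2_inner M X Y - a) \<le> F X"
    "c < L2_inner M X0 Y - a"
proof -
  define minorant where "minorant Y a \<longleftrightarrow> Y \<in> L2_space M \<and>
    (\<forall>X r. X \<in> L2_space M \<longrightarrow> F X \<le> ereal r \<longrightarrow> L2_inner M X Y - a \<le> r)" for Y a
  obtain u where u: "F U = ereal u" using U fin by (cases "F U") auto
  txt \<open>The alternative is whether the hyperplane supporting the epigraph at the projection of
    \<open>(X1, b)\<close> is vertical.\<close>
  have separate: "(\<exists>Y a. minorant Y a \<and> b < L2_inner M X1 Y - a) \<or>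
      (\<exists>W e. W \<in> L2_space M \<and> (\<forall>X r. X \<in> L2_space M \<longrightarrow> F X \<le> ereal r \<longrightarrow> L2_inner M X W \<le> e)
        \<and> e < L2_inner M X1 W)"
    if X1: "X1 \<in> L2_space M" "ereal b < F X1" for X1 b
  proof -
    obtain Z s where Z: "Z \<in> L2_space M" "F Z \<le> ereal s" and var: "\<And>X r. X \<in> L2_space M \<Longrightarrow> F X \<le> ereal r \<Longrightarrow>
        L2_inner M X (\<lambda>q. X1 q - Z q) - L2_inner M Z (\<lambda>q. X1 q - Z q) \<le> (s - b) * (r - s)"
      using epigraph_projection[OF cvx lsc U(1) _ X1(1), of u b] u by auto
    define W where "W = (\<lambda>q. X1 q - Z q)"
    have W: "W \<in> L2_space M" unfolding W_def by (rule L2_space_diff[OF X1(1) Z(1)])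
    have sq: "L2_inner M X1 W - L2_inner M Z W = L2_sqdist M X1 Z"
      using L2_sqdist_polar[OF X1(1) Z(1) X1(1)]
      by (simp add: W_def L2_sqdist_commute[of M Z] L2_sqdist_def[of M X1 X1])
    \<comment> \<open>The epigraph is closed upwards: testing at \<open>Z\<close> with a height
      above \<open>s\<close> shows that the normal does not point upwards.\<close>
    have "0 \<le> (s - b) * (max s u + 1 - s)"
    proof -
      have "F Z \<le> ereal (max s u + 1)" by (rule order.trans[OF Z(2)]) simp
      from var[OF Z(1) this] show ?thesis by simp
    qed
    then have "b \<le> s" by (auto simp: zero_le_mult_iff)
    show ?thesis
    proof (cases "b = s")
      case True
      \<comment> \<open>Distance zero gives \<open>X1 = Z\<close> only almost everywhere, so the
        values are compared by lower semicontinuity along the constant sequence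
        \<open>Z\<close>.\<close>
      have "L2_sqdist M X1 Z \<noteq> 0"
      proof
        assume "L2_sqdist M X1 Z = 0"
        then have "F X1 \<le> ereal s"
          by (intro lsc_on_L2_le[OF lsc _ X1(1), of "\<lambda>_. Z" "\<lambda>_. s"]) (simp_all add: Z)
        then show False using X1(2) True by simp
      qed
      then have "L2_inner M Z W < L2_inner M X1 W"
        using sq L2_sqdist_nonneg[of M X1 Z] by linarith
      moreover have "L2_inner M X W \<le> L2_inner M Z W" if "X \<in> L2_space M" "F X \<le> ereal r" for X r
        using var[OF that] True by (simp add: W_def)
      ultimately show ?thesis using W by blast
    next
      case False
      then have pos: "0 < s - b" using \<open>b \<le> s\<close> by simp
      define Y where "Y = (\<lambda>q. (1 / (s - b)) *\<^sub>R W q)"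
      define a where "a = L2_inner M Z W / (s - b) - s"
      have Y: "Y \<in> L2_space M" unfolding Y_def by (rule L2_space_scaleR[OF W])
      have YW: "L2_inner M X Y = L2_inner M X W / (s - b)" if "X \<in> L2_space M" for X
        unfolding Y_def using L2_inner_scaleR_right[OF that W] by simp
      have "L2_inner M X Y - a \<le> r" if X: "X \<in> L2_space M" "F X \<le> ereal r" for X r
      proof -
        have "(L2_inner M X W - L2_inner M Z W) / (s - b) \<le> r - s"
          using var[OF X] pos by (simp add: W_def pos_divide_le_eq mult.commute)
        then show ?thesis by (simp add: YW[OF X(1)] a_def diff_divide_distrib)
      qed
      then have "minorant Y a" using Y by (simp add: minorant_def)
      moreover have "b < L2_inner M X1 Y - a"
      proof -
        have "L2_inner M X1 Y - a = L2_sqdist M X1 Z / (s - b) + s"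
          by (simp add: YW[OF X1(1)] a_def sq[symmetric] diff_divide_distrib)
        moreover have "0 \<le> L2_sqdist M X1 Z / (s - b)" using pos L2_sqdist_nonneg[of M X1 Z] by simp
        ultimately show ?thesis using pos by linarith
      qed
      ultimately show ?thesis by blast
    qed
  qed
  have "\<exists>Y a. minorant Y a \<and> c < L2_inner M X0 Y - a"
  proof (rule ccontr)
    assume no: "\<not> ?thesis"
    then obtain W e where W: "W \<in> L2_space M" "\<And>X r. X \<in> L2_space M \<Longrightarrow> F X \<le> ereal r \<Longrightarrow> L2_inner M X W \<le> e"
      and We: "e < L2_inner M X0 W"
      using separate[OF X0] by blast
    \<comment> \<open>At \<open>U\<close> the vertical alternative is impossible, since
      \<open>U\<close> lies in the domain; any height below \<open>u\<close> would do.\<close>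
    obtain Y a where Y: "minorant Y a"
      using separate[OF U(1), of "u - 1"] u U by fastforce
    then have YL: "Y \<in> L2_space M" by (simp add: minorant_def)
    obtain k :: nat where k: "c - (L2_inner M X0 Y - a) < k * (L2_inner M X0 W - e)"
      using ex_less_of_nat_mult[of "L2_inner M X0 W - e"] We by auto
    define V where "V = (\<lambda>q. 1 *\<^sub>R Y q + real k *\<^sub>R W q)"
    have VL: "V \<in> L2_space M" unfolding V_def by (rule L2_space_lincomb[OF YL W(1)])
    have V: "L2_inner M X V = L2_inner M X Y + k * L2_inner M X W" if "X \<in> L2_space M" for X
      unfolding V_def using L2_inner_lincomb_left[OF YL W(1) that, of 1 "real k"]
      by (simp add: L2_inner_commute[of M X])
    have "L2_inner M X V - (a + k * e) \<le> r" if X: "X \<in> L2_space M" "F X \<le> ereal r" for X r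
    proof -
      have "L2_inner M X Y - a \<le> r" using Y X unfolding minorant_def by blast
      moreover have "k * L2_inner M X W \<le> k * e" using W(2)[OF X] by (intro mult_left_mono) auto
      ultimately show ?thesis by (simp add: V[OF X(1)])
    qed
    then have "minorant V (a + k * e)" using VL by (simp add: minorant_def)
    moreover have "c < L2_inner M X0 V - (a + k * e)"
      using k by (simp add: V[OF X0(1)] algebra_simps)
    ultimately show False using no by blast
  qed
  then obtain Y a where Y: "minorant Y a" "c < L2_inner M X0 Y - a" by blast
  have "ereal (L2_inner M X Y - a) \<le> F X" if X: "X \<in> L2_space M" for X
  proof (cases "F X")
    case (real r)
    then have "L2_inner M X Y - a \<le> r" using Y(1) X by (simp add: minorant_def)
    then show ?thesis by (simp add: real)
  qed (use fin[OF X] in auto)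
  with Y show thesis using that by (auto simp: minorant_def)
qed

section \<open>Couplings as joint laws\<close>

lemma P2_sets: "\<mu> \<in> P2 \<Longrightarrow> sets \<mu> = sets borel" and P2_prob: "\<mu> \<in> P2 \<Longrightarrow> prob_space \<mu>"
  by (simp_all add: P2_def)

lemma measurable_fst_borel [measurable]:
  "fst \<in> borel_measurable (borel :: ('a::topological_space \<times> 'b::topological_space) measure)"
  by (intro borel_measurable_continuous_onI continuous_intros)

lemma measurable_snd_borel [measurable]:
  "snd \<in> borel_measurable (borel :: ('a::topological_space \<times> 'b::topological_space) measure)"
  by (intro borel_measurable_continuous_onI continuous_intros)

lemma measurable_inner_borel [measurable]:
  "(\<lambda>(x, y). x \<bullet> y) \<in> borel_measurable (borel :: ('a::real_inner \<times> 'a) measure)"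
  unfolding case_prod_beta by (intro borel_measurable_continuous_onI continuous_intros)

lemma measurable_norm_diff_sq_borel [measurable]:
  "(\<lambda>(x, y). (norm (x - y))\<^sup>2) \<in> borel_measurable (borel :: ('a::real_normed_vector \<times> 'a) measure)"
  unfolding case_prod_beta by (intro borel_measurable_continuous_onI continuous_intros)

lemma measurable_lincomb_borel [measurable]:
  "(\<lambda>(x, y). a *\<^sub>R x + b *\<^sub>R y) \<in> borel_measurable (borel :: ('a::real_normed_vector \<times> 'a) measure)"
  unfolding case_prod_beta by (intro borel_measurable_continuous_onI continuous_intros)

context prob_space
begin

lemma distr_in_P2_iff:
  fixes Z :: "'a \<Rightarrow> 'b::{real_normed_vector, second_countable_topology}"
  assumes [measurable]: "Z \<in> borel_measurable M"
  shows "distr M borel Z \<in> P2 \<longleftrightarrow> integrable M (\<lambda>q. (norm (Z q))\<^sup>2)"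
  by (simp add: P2_def prob_space_distr integrable_distr_eq)

lemma push_in_P2_iff:
  fixes X :: "'a \<Rightarrow> 'h::{real_inner, polish_space}"
  shows "X \<in> borel_measurable M \<Longrightarrow> push M X \<in> P2 \<longleftrightarrow> X \<in> L2_space M"
  using distr_in_P2_iff[of X] by (simp add: push_def L2_space_def)

lemma push_in_P2: "X \<in> L2_space M \<Longrightarrow> push M X \<in> P2"
  using push_in_P2_iff L2_space_measurable by blast

lemma integral_norm_sq_push:
  "X \<in> L2_space M \<Longrightarrow> (\<integral>x. (norm x)\<^sup>2 \<partial>push M X) = (\<integral>q. (norm (X q))\<^sup>2 \<partial>M)"
  unfolding push_def by (subst integral_distr) (auto dest: L2_space_measurable)

lemma joint_law_in_couplings:
  fixes X Y :: "'a \<Rightarrow> 'h::{real_inner, polish_space}"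
  assumes [measurable]: "X \<in> borel_measurable M" "Y \<in> borel_measurable M"
  shows "distr M borel (\<lambda>q. (X q, Y q)) \<in> couplings (push M X) (push M Y)"
  by (auto simp: couplings_def push_def distr_distr comp_def intro!: prob_space_distr)

lemma joint_law_in_P2:
  fixes X Y :: "'a \<Rightarrow> 'h::{real_inner, polish_space}"
  assumes "X \<in> L2_space M" "Y \<in> L2_space M"
  shows "distr M borel (\<lambda>q. (X q, Y q)) \<in> P2"
proof -
  note [measurable] = assms[THEN L2_space_measurable]
  show ?thesis
    using assms[THEN L2_space_integrable] by (subst distr_in_P2_iff) (simp_all add: norm_Pair)
qed

lemma integral_joint_law:
  fixes f :: "'h::{real_inner, polish_space} \<Rightarrow> 'h \<Rightarrow> real"
  assumes [measurable]: "X \<in> borel_measurable M" "Y \<in> borel_measurable M"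
    "case_prod f \<in> borel_measurable borel"
  shows "(\<integral>(x, y). f x y \<partial>distr M borel (\<lambda>q. (X q, Y q))) = (\<integral>q. f (X q) (Y q) \<partial>M)"
  by (subst integral_distr) simp_all

lemma L2_inner_le_max_corr:
  assumes "X \<in> L2_space M" "Y \<in> L2_space M"
  shows "ereal (L2_inner M X Y) \<le> max_corr (push M X) (push M Y)"
proof -
  note [measurable] = assms[THEN L2_space_measurable]
  have "(\<integral>(x, y). x \<bullet> y \<partial>distr M borel (\<lambda>q. (X q, Y q))) = L2_inner M X Y"
    by (subst integral_joint_law) (simp_all add: L2_inner_def)
  then show ?thesis
    unfolding max_corr_def by (intro SUP_upper2[OF joint_law_in_couplings]) simp_all
qed

lemma w2_push_le:
  fixes X Y :: "'a \<Rightarrow> 'h::{real_inner, polish_space}"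
  assumes "X \<in> L2_space M" "Y \<in> L2_space M"
  shows "w2 (push M X) (push M Y) \<le> L2_distance M X Y"
proof -
  note [measurable] = assms[THEN L2_space_measurable]
  let ?I = "\<lambda>\<gamma>. \<integral>(x, y). (norm (x - y))\<^sup>2 \<partial>(\<gamma> :: ('h \<times> 'h) measure)"
  have "(INF \<gamma>\<in>couplings (push M X) (push M Y). ?I \<gamma>) \<le> ?I (distr M borel (\<lambda>q. (X q, Y q)))"
    by (intro cINF_lower joint_law_in_couplings bdd_belowI2[of _ 0] integral_nonneg_AE) auto
  also have "\<dots> = L2_sqdist M X Y"
    by (subst integral_joint_law) (simp_all add: L2_sqdist_def)
  finally show ?thesis by (simp add: w2_def L2_distance_eq)
qed

lemma totally_convex_imp_convex_L2:
  fixes \<phi> :: "'h::{real_inner, polish_space} measure \<Rightarrow> ereal"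
  assumes "totally_convex \<phi>"
  shows "convex_L2 M (\<phi> \<circ> push M)"
  unfolding convex_L2_def
proof (intro ballI)
  fix X Y :: "'a \<Rightarrow> 'h" and t :: real
  assume XY: "X \<in> L2_space M" "Y \<in> L2_space M" and t: "t \<in> {0..1}"
  note [measurable] = XY[THEN L2_space_measurable]
  have *: "distr (distr M borel (\<lambda>q. (X q, Y q))) borel f = push M (\<lambda>q. f (X q, Y q))"
    if [measurable]: "f \<in> borel_measurable borel" for f :: "'h \<times> 'h \<Rightarrow> 'h"
    by (simp add: distr_distr push_def comp_def)
  have "\<phi> (push M (\<lambda>q. case (X q, Y q) of (x1, x2) \<Rightarrow> (1 - t) *\<^sub>R x1 + t *\<^sub>R x2)) \<le>
    ereal (1 - t) * \<phi> (push M (\<lambda>q. fst (X q, Y q))) + ereal t * \<phi> (push M (\<lambda>q. snd (X q, Y q)))"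
    using assms joint_law_in_P2[OF XY] t unfolding totally_convex_def
    by (subst (1 2 3) *[symmetric]) (simp_all del: split_paired_All)
  then show "(\<phi> \<circ> push M) (\<lambda>q. (1 - t) *\<^sub>R X q + t *\<^sub>R Y q) \<le>
    ereal (1 - t) * (\<phi> \<circ> push M) X + ereal t * (\<phi> \<circ> push M) Y"
    by simp
qed

lemma lsc_w2_imp_lsc_L2:
  fixes \<phi> :: "'h::{real_inner, polish_space} measure \<Rightarrow> ereal"
  assumes "lsc_on P2 w2 \<phi>"
  shows "lsc_on (L2_space M) (L2_distance M) (\<phi> \<circ> push M)"
  unfolding lsc_on_def
proof (intro ballI allI impI)
  fix X :: "'a \<Rightarrow> 'h" and c
  assume X: "X \<in> L2_space M" and c: "c < (\<phi> \<circ> push M) X"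
  have "\<exists>d>0. \<forall>\<mu>\<in>P2. w2 (push M X) \<mu> < d \<longrightarrow> c < \<phi> \<mu>"
    using assms push_in_P2[OF X] c unfolding lsc_on_def comp_def by blast
  then obtain d where d: "d > 0" "\<And>\<mu>. \<mu> \<in> P2 \<Longrightarrow> w2 (push M X) \<mu> < d \<Longrightarrow> c < \<phi> \<mu>"
    by blast
  have "c < \<phi> (push M Y)" if "Y \<in> L2_space M" "L2_distance M X Y < d" for Y
    using that w2_push_le[OF X] push_in_P2 by (intro d(2)) (auto intro: le_less_trans)
  then show "\<exists>d>0. \<forall>Y\<in>L2_space M. L2_distance M X Y < d \<longrightarrow> c < (\<phi> \<circ> push M) Y"
    using d(1) by auto
qed

end

section \<open>Nearly optimal pairs of random variables\<close>

context atomless_prob_space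
begin

lemma realize_P2:
  assumes "\<mu> \<in> P2"
  obtains X where "X \<in> L2_space M" "push M X = \<mu>"
proof -
  obtain X where X: "X \<in> borel_measurable M" "distr M borel X = \<mu>"
    by (rule realize[OF P2_prob[OF assms] P2_sets[OF assms]])
  then show thesis using push_in_P2_iff[of X] assms that by (simp add: push_def)
qed

lemma realize_coupling:
  fixes \<gamma> :: "('h::{real_inner, polish_space} \<times> 'h) measure"
  assumes "\<gamma> \<in> couplings \<mu> \<nu>"
  obtains X Y where "X \<in> borel_measurable M" "Y \<in> borel_measurable M"
    "push M X = \<mu>" "push M Y = \<nu>" "distr M borel (\<lambda>q. (X q, Y q)) = \<gamma>"
proof -
  have \<gamma>: "prob_space \<gamma>" "sets \<gamma> = sets borel" "distr \<gamma> borel fst = \<mu>" "distr \<gamma> borel snd = \<nu>"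
    using assms by (auto simp: couplings_def)
  obtain Z where Z[measurable]: "Z \<in> borel_measurable M" and d: "distr M borel Z = \<gamma>"
    by (rule realize[OF \<gamma>(1,2)])
  have "push M (\<lambda>q. fst (Z q)) = \<mu>" "push M (\<lambda>q. snd (Z q)) = \<nu>"
    unfolding push_def \<gamma>(3,4)[symmetric] d[symmetric] by (simp_all add: distr_distr comp_def)
  then show thesis using d by (intro that[of "\<lambda>q. fst (Z q)" "\<lambda>q. snd (Z q)"]) simp_all
qed

text \<open>The loss \<open>e\<close> is unavoidable: \<open>X\<close> may generate the \<open>\<sigma>\<close>-algebra of \<open>M\<close>, and then every \<open>Y\<close> is
  a function of \<open>X\<close>. Discretizing \<open>X\<close> leaves an atomless space on each cell.\<close>
lemma rearrange_second_factor:
  fixes X X' Y' :: "'a \<Rightarrow> 'h::{real_inner, polish_space}"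
  assumes X: "X \<in> L2_space M" and X': "X' \<in> L2_space M" and Y': "Y' \<in> L2_space M"
    and eq: "push M X = push M X'" and "0 < e"
  obtains Y where "Y \<in> L2_space M" "push M Y = push M Y'" "L2_inner M X' Y' - e < L2_inner M X Y"
proof -
  note [measurable] = X[THEN L2_space_measurable] X'[THEN L2_space_measurable] Y'[THEN L2_space_measurable]
  \<comment> \<open>\<open>S\<close> depends only on the law of \<open>Y'\<close>; the same bound
    therefore serves for the variable \<open>Y\<close> still to be constructed.\<close>
  define S where "S = (\<integral>y. 1 + (norm y)\<^sup>2 \<partial>push M Y')"
  have S: "(\<integral>q. 1 + (norm (V q))\<^sup>2 \<partial>M) = S" if "V \<in> L2_space M" "push M V = push M Y'" for V :: "'a \<Rightarrow> 'h"
    unfolding S_def that(2)[symmetric] unfolding push_def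
    by (subst integral_distr) (use that(1) in \<open>auto dest: L2_space_measurable\<close>)
  have "S = 1 + (\<integral>q. (norm (Y' q))\<^sup>2 \<partial>M)"
    unfolding S[OF Y' refl, symmetric] using L2_space_integrable[OF Y'] by (simp add: prob_space)
  then have "1 \<le> S" by simp
  \<comment> \<open>Discretizing costs \<open>d * S\<close> once for \<open>X\<close> and once for
    \<open>X'\<close>; the total \<open>2 * e / 3\<close> stays below \<open>e\<close>.\<close>
  define d where "d = e / (3 * S)"
  have d: "0 < d" "2 * (d * S) < e" using \<open>0 < e\<close> \<open>1 \<le> S\<close> by (simp_all add: d_def)
  obtain a :: "nat \<Rightarrow> 'h" where a: "\<And>x e. 0 < e \<Longrightarrow> \<exists>i. dist x (a i) < e"
    by (metis dense_sequence)
  define i where "i x = (LEAST k. dist x (a k) < d)" for x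
  have [measurable]: "i \<in> borel \<rightarrow>\<^sub>M count_space UNIV" unfolding i_def by measurable
  have near: "norm (x - a (i x)) < d" for x
    unfolding i_def dist_norm[symmetric] by (rule LeastI_ex) (rule a[OF d(1)])
  have [measurable]: "(\<lambda>q. i (X q)) \<in> M \<rightarrow>\<^sub>M count_space UNIV" "(\<lambda>q. i (X' q)) \<in> M \<rightarrow>\<^sub>M count_space UNIV"
    by measurable
  have cell: "emeasure M ((\<lambda>q. i (V q)) -` {k} \<inter> space M) = emeasure (push M V) (i -` {k})"
    if [measurable]: "V \<in> borel_measurable M" for V k
  proof -
    have "i -` {k} \<inter> space borel \<in> sets borel" by (rule measurable_sets[of i _ "count_space UNIV"]) auto
    then show ?thesis by (simp add: push_def emeasure_distr vimage_comp comp_def)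
  qed
  obtain Y where Y[measurable]: "Y \<in> borel_measurable M"
    and law: "distr M borel (\<lambda>q. (a (i (X q)), Y q)) = distr M borel (\<lambda>q. (a (i (X' q)), Y' q))"
    by (rule rearrange_countable[of "\<lambda>q. i (X q)" "\<lambda>q. i (X' q)" Y' a]) (simp_all add: cell eq)
  have aiX: "(\<lambda>q. a (i (V q))) \<in> L2_space M" if "V \<in> L2_space M" for V
  proof (rule L2_spaceI_bound)
    have [measurable]: "V \<in> borel_measurable M" using that by (rule L2_space_measurable)
    have "(\<lambda>q. i (V q)) \<in> M \<rightarrow>\<^sub>M count_space UNIV" by measurable
    then show "(\<lambda>q. a (i (V q))) \<in> borel_measurable M" by (rule measurable_compose) simp
    show "integrable M (\<lambda>q. 2 * (norm (V q))\<^sup>2 + 2 * d\<^sup>2)" using L2_space_integrable[OF that] by simp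
    show "(norm (a (i (V q))))\<^sup>2 \<le> 2 * (norm (V q))\<^sup>2 + 2 * d\<^sup>2" for q
      using norm_diff_sq_le[of "V q" "V q - a (i (V q))"]
        power_mono[OF less_imp_le[OF near[of "V q"]], of 2] by simp
  qed
  note [measurable] = aiX[OF X, THEN L2_space_measurable] aiX[OF X', THEN L2_space_measurable]
  have "push M Y = distr (distr M borel (\<lambda>q. (a (i (X q)), Y q))) borel snd"
    by (simp add: distr_distr comp_def push_def)
  also have "\<dots> = push M Y'" unfolding law by (simp add: distr_distr comp_def push_def)
  finally have pY: "push M Y = push M Y'" .
  then have YL: "Y \<in> L2_space M" using push_in_P2_iff[OF Y] push_in_P2[OF Y'] by simp
  have approx: "\<bar>L2_inner M V W - L2_inner M (\<lambda>q. a (i (V q))) W\<bar> \<le> d * S"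
    if V: "V \<in> L2_space M" and W: "W \<in> L2_space M" "push M W = push M Y'" for V W
  proof -
    have "\<bar>(x - a (i x)) \<bullet> y\<bar> \<le> d * (1 + (norm y)\<^sup>2)" for x y :: 'h
    proof -
      have "\<bar>(x - a (i x)) \<bullet> y\<bar> \<le> norm (x - a (i x)) * norm y" by (rule Cauchy_Schwarz_ineq2)
      also have "\<dots> \<le> d * norm y" by (intro mult_right_mono less_imp_le[OF near]) simp
      also have "\<dots> \<le> d * (1 + (norm y)\<^sup>2)"
      proof (intro mult_left_mono less_imp_le[OF d(1)])
        show "norm y \<le> 1 + (norm y)\<^sup>2"
          using zero_le_power2[of "norm y - 1"] zero_le_power2[of "norm y"]
          unfolding power2_diff power_one by linarith
      qed
      finally show ?thesis .
    qed
    then have "(\<integral>q. \<bar>(V q - a (i (V q))) \<bullet> W q\<bar> \<partial>M) \<le> (\<integral>q. d * (1 + (norm (W q))\<^sup>2) \<partial>M)"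
      using L2_inner_integrable[OF L2_space_diff[OF V aiX[OF V]] W(1)] L2_space_integrable[OF W(1)]
      by (intro integral_mono) auto
    also have "\<dots> = d * S" using S[OF W] by simp
    finally have "(\<integral>q. \<bar>(V q - a (i (V q))) \<bullet> W q\<bar> \<partial>M) \<le> d * S" .
    then have "\<bar>L2_inner M (\<lambda>q. V q - a (i (V q))) W\<bar> \<le> d * S"
      unfolding L2_inner_def by (rule order.trans[OF integral_abs_bound])
    then show ?thesis by (simp add: L2_inner_diff_left[OF V aiX[OF V] W(1)])
  qed
  \<comment> \<open>The discretized pairs have the same joint law, so their correlations agree
    exactly; the whole error lies in replacing \<open>X\<close> and \<open>X'\<close> by their
    discretizations.\<close>
  have "L2_inner M (\<lambda>q. a (i (X q))) Y = (\<integral>(x, y). x \<bullet> y \<partial>distr M borel (\<lambda>q. (a (i (X q)), Y q)))"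
    unfolding L2_inner_def by (subst integral_joint_law) simp_all
  also have "\<dots> = L2_inner M (\<lambda>q. a (i (X' q))) Y'"
    unfolding L2_inner_def law by (subst integral_joint_law) simp_all
  finally have "L2_inner M X' Y' - e < L2_inner M X Y"
    using approx[OF X YL pY] approx[OF X' Y' refl] d(2) by linarith
  with YL pY show thesis by (rule that)
qed

lemma less_max_corr_realize:
  fixes \<mu> \<nu> :: "'h::{real_inner, polish_space} measure"
  assumes "\<mu> \<in> P2" "\<nu> \<in> P2" "b < max_corr \<mu> \<nu>"
  obtains X Y where "X \<in> L2_space M" "Y \<in> L2_space M" "push M X = \<mu>" "push M Y = \<nu>"
    "b < ereal (L2_inner M X Y)"
proof -
  obtain \<gamma> where \<gamma>: "\<gamma> \<in> couplings \<mu> \<nu>" "b < ereal (\<integral>(x, y). x \<bullet> y \<partial>\<gamma>)"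
    using assms(3) unfolding max_corr_def less_SUP_iff by blast
  obtain X Y where XY: "X \<in> borel_measurable M" "Y \<in> borel_measurable M"
    "push M X = \<mu>" "push M Y = \<nu>" "distr M borel (\<lambda>q. (X q, Y q)) = \<gamma>"
    by (rule realize_coupling[OF \<gamma>(1)])
  have "(\<integral>(x, y). x \<bullet> y \<partial>\<gamma>) = L2_inner M X Y"
    unfolding XY(5)[symmetric] L2_inner_def by (subst integral_joint_law[OF XY(1,2)]) simp_all
  then show thesis
    using XY \<gamma>(2) assms push_in_P2_iff[OF XY(1)] push_in_P2_iff[OF XY(2)] by (intro that[of X Y]) auto
qed

lemma less_max_corr_realize_first:
  fixes X :: "'a \<Rightarrow> 'h::{real_inner, polish_space}"
  assumes X: "X \<in> L2_space M" and \<nu>: "\<nu> \<in> P2" and b: "ereal b < max_corr (push M X) \<nu>"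
  obtains Y where "Y \<in> L2_space M" "push M Y = \<nu>" "b < L2_inner M X Y"
proof -
  obtain X' Y' where *: "X' \<in> L2_space M" "Y' \<in> L2_space M" "push M X' = push M X" "push M Y' = \<nu>"
    "b < L2_inner M X' Y'"
    using less_max_corr_realize[OF push_in_P2[OF X] \<nu> b] by auto
  obtain Y where "Y \<in> L2_space M" "push M Y = push M Y'"
    "L2_inner M X' Y' - (L2_inner M X' Y' - b) < L2_inner M X Y"
    by (rule rearrange_second_factor[OF X *(1,2), of "L2_inner M X' Y' - b"]) (use * in auto)
  then show thesis using that * by simp
qed

text \<open>Finiteness keeps \<open>\<infinity> - \<infinity>\<close> out of the differences in
  \<open>kl_conj\<close>. The upper bound is the sum of the second moments; the lower one comes from
  any pair of variables with these laws.\<close>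

lemma max_corr_finite:
  fixes \<mu> \<nu> :: "'h::{real_inner, polish_space} measure"
  assumes "\<mu> \<in> P2" "\<nu> \<in> P2"
  obtains m where "max_corr \<mu> \<nu> = ereal m"
proof -
  obtain X Y where XY: "X \<in> L2_space M" "push M X = \<mu>" "Y \<in> L2_space M" "push M Y = \<nu>"
    using realize_P2 assms by metis
  then have "ereal (L2_inner M X Y) \<le> max_corr \<mu> \<nu>" using L2_inner_le_max_corr by blast
  moreover have "max_corr \<mu> \<nu> \<le> ereal ((\<integral>x. (norm x)\<^sup>2 \<partial>\<mu>) + (\<integral>y. (norm y)\<^sup>2 \<partial>\<nu>))" (is "_ \<le> ?B")
  proof (rule ccontr)
    assume "\<not> ?thesis"
    then have "?B < max_corr \<mu> \<nu>" by simp
    then obtain X Y where XY: "X \<in> L2_space M" "Y \<in> L2_space M" "push M X = \<mu>" "push M Y = \<nu>"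
      and less: "?B < ereal (L2_inner M X Y)"
      by (rule less_max_corr_realize[OF assms])
    have "L2_inner M X Y \<le> (\<integral>q. (norm (X q))\<^sup>2 + (norm (Y q))\<^sup>2 \<partial>M)"
      unfolding L2_inner_def
    proof (intro integral_mono L2_inner_integrable XY Bochner_Integration.integrable_add L2_space_integrable)
      show "x \<bullet> y \<le> (norm x)\<^sup>2 + (norm y)\<^sup>2" for x y :: 'h
        using norm_cauchy_schwarz[of x y] zero_le_power2[of "norm x - norm y"]
          zero_le_power2[of "norm x"] zero_le_power2[of "norm y"]
        unfolding power2_diff by linarith
    qed
    also have "\<dots> = (\<integral>x. (norm x)\<^sup>2 \<partial>\<mu>) + (\<integral>y. (norm y)\<^sup>2 \<partial>\<nu>)"
      using XY L2_space_integrable[OF XY(1)] L2_space_integrable[OF XY(2)]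
        integral_norm_sq_push[OF XY(1)] integral_norm_sq_push[OF XY(2)] by simp
    finally show False using less by simp
  qed
  ultimately show thesis using that by (cases "max_corr \<mu> \<nu>") auto
qed

text \<open>Swapping the two variables of a realizing pair gives the other order. The conjugate and
  the biconjugate list the two measures in opposite orders, so comparing them calls for this
  symmetry.\<close>

lemma max_corr_commute:
  fixes \<mu> \<nu> :: "'h::{real_inner, polish_space} measure"
  assumes "\<mu> \<in> P2" "\<nu> \<in> P2"
  shows "max_corr \<mu> \<nu> = max_corr \<nu> \<mu>"
proof -
  have "max_corr \<mu> \<nu> \<le> max_corr \<nu> \<mu>" if P: "\<mu> \<in> P2" "\<nu> \<in> P2" for \<mu> \<nu> :: "'h measure"
  proof (rule ccontr)
    assume "\<not> ?thesis"
    then have "max_corr \<nu> \<mu> < max_corr \<mu> \<nu>" by simp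
    then obtain X Y where XY: "X \<in> L2_space M" "Y \<in> L2_space M" "push M X = \<mu>" "push M Y = \<nu>"
      "max_corr \<nu> \<mu> < ereal (L2_inner M X Y)"
      by (rule less_max_corr_realize[OF P])
    then show False using L2_inner_le_max_corr[OF XY(2,1)] by (simp add: L2_inner_commute)
  qed
  then show ?thesis using assms by (intro order.antisym) auto
qed

lemma w2_less_realize:
  fixes \<mu> \<nu> :: "'h::{real_inner, polish_space} measure"
  assumes "\<mu> \<in> P2" "\<nu> \<in> P2" "w2 \<mu> \<nu> < d"
  obtains X Y where "X \<in> L2_space M" "Y \<in> L2_space M" "push M X = \<mu>" "push M Y = \<nu>"
    "L2_distance M X Y < d"
proof -
  let ?I = "\<lambda>\<gamma>. \<integral>(x, y). (norm (x - y))\<^sup>2 \<partial>(\<gamma> :: ('h \<times> 'h) measure)"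
  have bdd: "bdd_below (?I ` couplings \<mu> \<nu>)"
    by (intro bdd_belowI2[of _ 0] integral_nonneg_AE) auto
  obtain X0 Y0 where XY0: "X0 \<in> L2_space M" "push M X0 = \<mu>" "Y0 \<in> L2_space M" "push M Y0 = \<nu>"
    using realize_P2 assms by metis
  then have ne: "couplings \<mu> \<nu> \<noteq> {}" using joint_law_in_couplings L2_space_measurable by blast
  have "0 \<le> (INF \<gamma>\<in>couplings \<mu> \<nu>. ?I \<gamma>)"
    by (intro cINF_greatest ne integral_nonneg_AE) auto
  then have "0 \<le> w2 \<mu> \<nu>" by (simp add: w2_def)
  then have d0: "0 < d" using assms(3) by simp
  then have "sqrt (INF \<gamma>\<in>couplings \<mu> \<nu>. ?I \<gamma>) < sqrt (d\<^sup>2)"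
    using assms(3) by (simp add: w2_def)
  then have "(INF \<gamma>\<in>couplings \<mu> \<nu>. ?I \<gamma>) < d\<^sup>2" by (simp only: real_sqrt_less_iff)
  then obtain \<gamma> where \<gamma>: "\<gamma> \<in> couplings \<mu> \<nu>" "?I \<gamma> < d\<^sup>2"
    by (subst (asm) cINF_less_iff[OF ne bdd]) auto
  obtain X Y where XY: "X \<in> borel_measurable M" "Y \<in> borel_measurable M"
    "push M X = \<mu>" "push M Y = \<nu>" "distr M borel (\<lambda>q. (X q, Y q)) = \<gamma>"
    by (rule realize_coupling[OF \<gamma>(1)])
  have "?I \<gamma> = L2_sqdist M X Y"
    unfolding XY(5)[symmetric] L2_sqdist_def by (subst integral_joint_law[OF XY(1,2)]) simp_all
  then have "sqrt (L2_sqdist M X Y) < sqrt (d\<^sup>2)" using \<gamma>(2) by (simp only: real_sqrt_less_iff)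
  then have "L2_distance M X Y < d" using d0 by (simp add: L2_distance_eq)
  then show thesis
    using XY assms push_in_P2_iff[OF XY(1)] push_in_P2_iff[OF XY(2)] by (intro that[of X Y]) auto
qed

section \<open>Convexity and lower semicontinuity of the maximal correlation\<close>

text \<open>For fixed \<open>\<nu>\<close>, the maximal correlation is a supremum of functions
  linear in \<open>X\<close>, one for each \<open>Y\<close> of law \<open>\<nu>\<close>; a
  \<open>Y\<close> nearly optimal for the combination competes at both endpoints at once.\<close>

lemma max_corr_convex_comb_le:
  fixes X0 X1 :: "'a \<Rightarrow> 'h::{real_inner, polish_space}"
  assumes X: "X0 \<in> L2_space M" "X1 \<in> L2_space M" and \<nu>: "\<nu> \<in> P2" and t: "0 \<le> t" "t \<le> 1"
    and m: "max_corr (push M X0) \<nu> \<le> ereal m0" "max_corr (push M X1) \<nu> \<le> ereal m1"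
  shows "max_corr (push M (\<lambda>q. (1 - t) *\<^sub>R X0 q + t *\<^sub>R X1 q)) \<nu> \<le> ereal ((1 - t) * m0 + t * m1)"
proof (rule ccontr)
  assume "\<not> ?thesis"
  then have "ereal ((1 - t) * m0 + t * m1) < max_corr (push M (\<lambda>q. (1 - t) *\<^sub>R X0 q + t *\<^sub>R X1 q)) \<nu>" by simp
  then obtain Y where Y: "Y \<in> L2_space M" "push M Y = \<nu>"
    "(1 - t) * m0 + t * m1 < L2_inner M (\<lambda>q. (1 - t) *\<^sub>R X0 q + t *\<^sub>R X1 q) Y"
    by (rule less_max_corr_realize_first[OF L2_space_lincomb[OF X] \<nu>])
  have "L2_inner M X0 Y \<le> m0" "L2_inner M X1 Y \<le> m1"
    using L2_inner_le_max_corr[OF X(1) Y(1)] L2_inner_le_max_corr[OF X(2) Y(1)] m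
    by (auto simp: Y(2) dest: order.trans)
  then have "(1 - t) * L2_inner M X0 Y + t * L2_inner M X1 Y \<le> (1 - t) * m0 + t * m1"
    using t by (intro add_mono mult_left_mono) auto
  then show False using Y(3) by (simp add: L2_inner_lincomb_left[OF X Y(1)])
qed

text \<open>A law close to \<open>\<mu>\<close> is realized by some \<open>X'\<close> close to an
  \<open>X\<close> of law \<open>\<mu>\<close>. A \<open>Y\<close> nearly optimal for this
  particular \<open>X\<close> remains good for \<open>X'\<close>, which bounds the correlation from
  below.\<close>

lemma lsc_max_corr:
  fixes \<nu> :: "'h::{real_inner, polish_space} measure"
  assumes \<nu>: "\<nu> \<in> P2"
  shows "lsc_on P2 w2 (\<lambda>\<mu>. max_corr \<mu> \<nu>)"
  unfolding lsc_on_def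
proof (intro ballI allI impI)
  fix \<mu> :: "'h measure" and c assume \<mu>: "\<mu> \<in> P2" and c: "c < max_corr \<mu> \<nu>"
  obtain b where b: "c < ereal b" "ereal b < max_corr \<mu> \<nu>" using ereal_dense2[OF c] by blast
  obtain b' where b': "ereal b < ereal b'" "ereal b' < max_corr \<mu> \<nu>" using ereal_dense2[OF b(2)] by blast
  define S where "S = (\<integral>y. (norm y)\<^sup>2 \<partial>\<nu>)"
  have "0 \<le> S" unfolding S_def by (rule integral_nonneg_AE) auto
  \<comment> \<open>Twice the loss in correlation is at most
    \<open>L2_sqdist M X X' / h + h * S\<close>; \<open>h\<close> keeps the second term within the
    gap \<open>b' - b\<close>, and \<open>d\<close> the first. The \<open>+ 1\<close> covers
    \<open>S = 0\<close>.\<close>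
  define h where "h = (b' - b) / (S + 1)"
  have h: "0 < h" "h * S \<le> b' - b" using b'(1) \<open>0 \<le> S\<close> by (simp_all add: h_def field_simps)
  define d where "d = sqrt (h * (b' - b))"
  have d: "0 < d" "d\<^sup>2 / h = b' - b" using b'(1) h(1) by (simp_all add: d_def)
  have "c < max_corr \<mu>' \<nu>" if \<mu>': "\<mu>' \<in> P2" "w2 \<mu> \<mu>' < d" for \<mu>'
  proof -
    obtain X X' where X: "X \<in> L2_space M" "X' \<in> L2_space M" "push M X = \<mu>" "push M X' = \<mu>'"
      and dist: "L2_distance M X X' < d"
      by (rule w2_less_realize[OF \<mu> \<mu>'])
    obtain Y where Y: "Y \<in> L2_space M" "push M Y = \<nu>" "b' < L2_inner M X Y"
      by (rule less_max_corr_realize_first[OF X(1) \<nu>, of b']) (use b' X in auto)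
    have "L2_sqdist M X X' < d\<^sup>2"
      using dist real_less_rsqrt[of "L2_distance M X X'"] d(1) L2_sqdist_nonneg[of M X X']
        power_strict_mono[OF dist, of 2] by (simp add: L2_distance_eq)
    then have "L2_sqdist M X X' / h < b' - b" using h(1) d(2) by (metis divide_strict_right_mono)
    moreover have "2 * L2_inner M (\<lambda>q. X q - X' q) Y \<le> L2_sqdist M X X' / h + h * S"
    proof -
      have le: "2 * (x \<bullet> y) \<le> (norm x)\<^sup>2 / h + h * (norm y)\<^sup>2" for x y :: 'h
      proof -
        have "0 \<le> (norm x - h * norm y)\<^sup>2 / h" using h(1) by simp
        also have "\<dots> = (norm x)\<^sup>2 / h + h * (norm y)\<^sup>2 - 2 * (norm x * norm y)"
          using h(1) by (simp add: power2_eq_square field_simps)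
        finally show ?thesis using norm_cauchy_schwarz[of x y] by linarith
      qed
      have "2 * L2_inner M (\<lambda>q. X q - X' q) Y = (\<integral>q. 2 * ((X q - X' q) \<bullet> Y q) \<partial>M)"
        by (simp add: L2_inner_def)
      also have "\<dots> \<le> (\<integral>q. (norm (X q - X' q))\<^sup>2 / h + h * (norm (Y q))\<^sup>2 \<partial>M)"
        using L2_inner_integrable[OF L2_space_diff[OF X(1,2)] Y(1)] L2_sqdist_integrable[OF X(1,2)]
          L2_space_integrable[OF Y(1)]
        by (intro integral_mono le) auto
      also have "\<dots> = L2_sqdist M X X' / h + h * S"
        using L2_sqdist_integrable[OF X(1,2)] L2_space_integrable[OF Y(1)] integral_norm_sq_push[OF Y(1)]
        by (simp add: L2_sqdist_def S_def Y(2))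
      finally show ?thesis .
    qed
    ultimately have "b < L2_inner M X' Y"
      using Y(3) h(2) L2_inner_diff_left[OF X(1,2) Y(1)] by linarith
    then have "c < ereal (L2_inner M X' Y)" using b(1) by (auto intro: less_trans)
    also have "\<dots> \<le> max_corr \<mu>' \<nu>" using L2_inner_le_max_corr[OF X(2) Y(1)] by (simp add: X Y)
    finally show ?thesis .
  qed
  then show "\<exists>d>0. \<forall>\<mu>'\<in>P2. w2 \<mu> \<mu>' < d \<longrightarrow> c < max_corr \<mu>' \<nu>" using d(1) by blast
qed

end

section \<open>The biconjugate\<close>

context atomless_prob_space
begin

text \<open>One direction is the Fenchel-Young inequality. For the other, a minorant
  \<open>L2_inner M X Y - a\<close> bounds the conjugate at \<open>push M Y\<close> by
  \<open>a\<close>, so this one measure already lifts the biconjugate above a given \<open>c\<close>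
  below \<open>\<phi> \<mu>\<close>.\<close>

lemma lagrangian_imp_biconjugate:
  fixes \<phi> :: "'h::{real_inner, polish_space} measure \<Rightarrow> ereal"
  assumes fin: "\<And>\<mu>. \<mu> \<in> P2 \<Longrightarrow> \<phi> \<mu> \<noteq> -\<infinity>" and "proper_on P2 \<phi>"
    and cvx: "convex_L2 M (\<phi> \<circ> push M)" and lsc: "lsc_on (L2_space M) (L2_distance M) (\<phi> \<circ> push M)"
    and \<mu>: "\<mu> \<in> P2"
  shows "\<phi> \<mu> = kl_conj (kl_conj \<phi>) \<mu>"
proof (rule order.antisym)
  show "kl_conj (kl_conj \<phi>) \<mu> \<le> \<phi> \<mu>"
    unfolding kl_conj_def[of "kl_conj \<phi>"]
  proof (rule SUP_least)
    fix \<nu> :: "'h measure" assume \<nu>: "\<nu> \<in> P2"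
    obtain m where m: "max_corr \<nu> \<mu> = ereal m" by (rule max_corr_finite[OF \<nu> \<mu>])
    have "max_corr \<nu> \<mu> - \<phi> \<mu> \<le> kl_conj \<phi> \<nu>"
      unfolding kl_conj_def by (rule SUP_upper[OF \<mu>])
    then show "max_corr \<mu> \<nu> - kl_conj \<phi> \<nu> \<le> \<phi> \<mu>"
      using fin[OF \<mu>] unfolding max_corr_commute[OF \<mu> \<nu>] m
      by (cases "\<phi> \<mu>"; cases "kl_conj \<phi> \<nu>") auto
  qed
  show "\<phi> \<mu> \<le> kl_conj (kl_conj \<phi>) \<mu>"
  proof (rule ccontr)
    assume "\<not> ?thesis"
    then have "kl_conj (kl_conj \<phi>) \<mu> < \<phi> \<mu>" by (simp only: not_le)
    then obtain c where c: "kl_conj (kl_conj \<phi>) \<mu> < ereal c" "ereal c < \<phi> \<mu>"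
      using ereal_dense2 by blast
    obtain X0 where X0: "X0 \<in> L2_space M" "push M X0 = \<mu>" by (rule realize_P2[OF \<mu>])
    obtain \<mu>1 where \<mu>1: "\<mu>1 \<in> P2" "\<phi> \<mu>1 \<noteq> \<infinity>" using assms(2) by (auto simp: proper_on_def)
    obtain U where U: "U \<in> L2_space M" "push M U = \<mu>1" by (rule realize_P2[OF \<mu>1(1)])
    have "(\<phi> \<circ> push M) X \<noteq> -\<infinity>" if "X \<in> L2_space M" for X using fin[OF push_in_P2[OF that]] by simp
    moreover have "(\<phi> \<circ> push M) U \<noteq> \<infinity>" "ereal c < (\<phi> \<circ> push M) X0" using U \<mu>1 X0 c by simp_all
    ultimately obtain Y a where Y: "Y \<in> L2_space M"
      and minor: "\<And>X. X \<in> L2_space M \<Longrightarrow> ereal (L2_inner M X Y - a) \<le> (\<phi> \<circ> push M) X"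
      and above: "c < L2_inner M X0 Y - a"
      using affine_minorant[OF cvx lsc _ U(1) _ X0(1), of c] by metis
    let ?\<nu> = "push M Y"
    have \<nu>: "?\<nu> \<in> P2" by (rule push_in_P2[OF Y])
    have conj_le: "kl_conj \<phi> ?\<nu> \<le> ereal a"
      unfolding kl_conj_def
    proof (rule SUP_least)
      fix \<rho> :: "'h measure" assume \<rho>: "\<rho> \<in> P2"
      obtain m where m: "max_corr ?\<nu> \<rho> = ereal m" by (rule max_corr_finite[OF \<nu> \<rho>])
      show "max_corr ?\<nu> \<rho> - \<phi> \<rho> \<le> ereal a"
      proof (cases "\<phi> \<rho>")
        case (real r)
        have "m \<le> r + a + e" if "0 < e" for e
        proof -
          have "ereal (m - e) < max_corr ?\<nu> \<rho>" using m that by simp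
          then obtain X where X: "X \<in> L2_space M" "push M X = \<rho>" "m - e < L2_inner M Y X"
            by (rule less_max_corr_realize_first[OF Y \<rho>])
          have "L2_inner M X Y - a \<le> r" using minor[OF X(1)] by (simp add: X real)
          then show ?thesis using X(3) by (simp add: L2_inner_commute)
        qed
        then have "m \<le> r + a" by (rule field_le_epsilon)
        then show ?thesis by (simp add: m real)
      qed (use fin[OF \<rho>] m in auto)
    qed
    have "ereal (L2_inner M X0 Y) \<le> max_corr \<mu> ?\<nu>" using L2_inner_le_max_corr[OF X0(1) Y] by (simp add: X0)
    then have "ereal (L2_inner M X0 Y) - ereal a \<le> max_corr \<mu> ?\<nu> - kl_conj \<phi> ?\<nu>"
      by (rule ereal_minus_mono[OF _ conj_le])
    also have "\<dots> \<le> kl_conj (kl_conj \<phi>) \<mu>"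
      unfolding kl_conj_def[of "kl_conj \<phi>"] by (rule SUP_upper[OF \<nu>])
    finally have "ereal (L2_inner M X0 Y) - ereal a < ereal c" using c(1) by (rule le_less_trans)
    then show False using above by simp
  qed
qed

text \<open>Points where the conjugate is \<open>\<infinity>\<close> contribute
  \<open>-\<infinity>\<close> to the supremum and may be dropped; the value
  \<open>-\<infinity>\<close> is excluded since \<open>\<phi> \<mu>1\<close> is finite for some
  \<open>\<mu>1\<close>.\<close>

lemma biconjugate_imp_sup:
  fixes \<phi> :: "'h::{real_inner, polish_space} measure \<Rightarrow> ereal"
  assumes fin: "\<And>\<mu>. \<mu> \<in> P2 \<Longrightarrow> \<phi> \<mu> \<noteq> -\<infinity>" and "proper_on P2 \<phi>"
    and eq: "\<And>\<mu>. \<mu> \<in> P2 \<Longrightarrow> \<phi> \<mu> = kl_conj (kl_conj \<phi>) \<mu>" and \<mu>: "\<mu> \<in> P2"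
  shows "\<phi> \<mu> = (SUP (\<nu>, a)\<in>{(\<nu>, a). \<nu> \<in> P2 \<and> kl_conj \<phi> \<nu> = ereal a}. max_corr \<mu> \<nu> - ereal a)"
    (is "_ = (SUP p\<in>?G. ?f p)")
proof (rule order.antisym)
  obtain \<mu>1 where \<mu>1: "\<mu>1 \<in> P2" "\<phi> \<mu>1 \<noteq> \<infinity>" using assms(2) by (auto simp: proper_on_def)
  then obtain r where r: "\<phi> \<mu>1 = ereal r" using fin by (cases "\<phi> \<mu>1") auto
  have "max_corr \<mu> \<nu> - kl_conj \<phi> \<nu> \<le> (SUP p\<in>?G. ?f p)" if \<nu>: "\<nu> \<in> P2" for \<nu>
  proof (cases "kl_conj \<phi> \<nu>")
    case (real a)
    then have "?f (\<nu>, a) \<le> (SUP p\<in>?G. ?f p)" using \<nu> by (intro SUP_upper) auto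
    then show ?thesis by (simp add: real)
  next
    case PInf
    obtain m where "max_corr \<mu> \<nu> = ereal m" by (rule max_corr_finite[OF \<mu> \<nu>])
    then show ?thesis by (simp add: PInf)
  next
    case MInf
    obtain m where "max_corr \<nu> \<mu>1 = ereal m" by (rule max_corr_finite[OF \<nu> \<mu>1(1)])
    moreover have "max_corr \<nu> \<mu>1 - \<phi> \<mu>1 \<le> kl_conj \<phi> \<nu>"
      unfolding kl_conj_def by (rule SUP_upper[OF \<mu>1(1)])
    ultimately show ?thesis by (simp add: MInf r)
  qed
  then show "\<phi> \<mu> \<le> (SUP p\<in>?G. ?f p)"
    unfolding eq[OF \<mu>] kl_conj_def[of "kl_conj \<phi>"] by (rule SUP_least)
  show "(SUP p\<in>?G. ?f p) \<le> \<phi> \<mu>"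
    unfolding eq[OF \<mu>] kl_conj_def[of "kl_conj \<phi>"]
  proof (rule SUP_least)
    fix p assume "p \<in> ?G"
    then obtain \<nu> a where p: "p = (\<nu>, a)" "\<nu> \<in> P2" "kl_conj \<phi> \<nu> = ereal a" by auto
    then show "?f p \<le> (SUP \<nu>\<in>P2. max_corr \<mu> \<nu> - kl_conj \<phi> \<nu>)"
      by (intro SUP_upper2[of \<nu>]) auto
  qed
qed

text \<open>Each \<open>max_corr \<mu> \<nu> - ereal a\<close> is totally convex, the constant
  splitting as \<open>(1 - t) * a + t * a\<close>. The given measure on pairs is written as the
  joint law of two variables on \<open>M\<close>, to which \<open>max_corr_convex_comb_le\<close>
  applies.\<close>

lemma sup_imp_totally_convex:
  fixes \<phi> :: "'h::{real_inner, polish_space} measure \<Rightarrow> ereal"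
  assumes G: "G \<subseteq> P2 \<times> UNIV"
    and eq: "\<And>\<mu>. \<mu> \<in> P2 \<Longrightarrow> \<phi> \<mu> = (SUP (\<nu>, a)\<in>G. max_corr \<mu> \<nu> - ereal a)"
  shows "totally_convex \<phi>"
  unfolding totally_convex_def
proof (intro ballI)
  fix \<gamma> :: "('h \<times> 'h) measure" and t :: real
  assume \<gamma>: "\<gamma> \<in> P2" and t: "t \<in> {0..1}"
  obtain Z where Z[measurable]: "Z \<in> borel_measurable M" and d: "distr M borel Z = \<gamma>"
    by (rule realize[OF P2_prob[OF \<gamma>] P2_sets[OF \<gamma>]])
  define X0 where "X0 q = fst (Z q)" for q
  define X1 where "X1 q = snd (Z q)" for q
  have int: "integrable M (\<lambda>q. (norm (Z q))\<^sup>2)" using \<gamma> distr_in_P2_iff[OF Z] d by simp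
  have proj: "norm (fst z) \<le> norm z" "norm (snd z) \<le> norm z" for z :: "'h \<times> 'h"
    by (metis norm_fst_le prod.collapse) (metis norm_snd_le prod.collapse)
  have "X0 \<in> L2_space M"
    by (rule L2_spaceI_bound[OF _ int]) (simp_all add: X0_def[abs_def] proj power_mono)
  moreover have "X1 \<in> L2_space M"
    by (rule L2_spaceI_bound[OF _ int]) (simp_all add: X1_def[abs_def] proj power_mono)
  ultimately have X: "X0 \<in> L2_space M" "X1 \<in> L2_space M" .
  have marg: "distr \<gamma> borel fst = push M X0" "distr \<gamma> borel snd = push M X1"
    "distr \<gamma> borel (\<lambda>(x1, x2). (1 - t) *\<^sub>R x1 + t *\<^sub>R x2) = push M (\<lambda>q. (1 - t) *\<^sub>R X0 q + t *\<^sub>R X1 q)"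
    unfolding d[symmetric] push_def X0_def X1_def by (simp_all add: distr_distr comp_def case_prod_beta)
  have le: "ereal m - ereal a \<le> \<phi> \<mu>" if "(\<nu>, a) \<in> G" "\<mu> \<in> P2" "max_corr \<mu> \<nu> = ereal m" for m a \<mu> \<nu>
    unfolding eq[OF that(2)] by (rule SUP_upper2[OF that(1)]) (simp add: that(3))
  have "\<phi> (push M (\<lambda>q. (1 - t) *\<^sub>R X0 q + t *\<^sub>R X1 q)) \<le>
      ereal (1 - t) * \<phi> (push M X0) + ereal t * \<phi> (push M X1)"
    unfolding eq[OF push_in_P2[OF L2_space_lincomb[OF X]]]
  proof (rule SUP_least, clarify)
    fix \<nu> a assume mem: "(\<nu>, a) \<in> G"
    then have \<nu>: "\<nu> \<in> P2" using G by auto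
    obtain m0 where m0: "max_corr (push M X0) \<nu> = ereal m0" by (rule max_corr_finite[OF push_in_P2[OF X(1)] \<nu>])
    obtain m1 where m1: "max_corr (push M X1) \<nu> = ereal m1" by (rule max_corr_finite[OF push_in_P2[OF X(2)] \<nu>])
    have "max_corr (push M (\<lambda>q. (1 - t) *\<^sub>R X0 q + t *\<^sub>R X1 q)) \<nu> - ereal a \<le>
        ereal ((1 - t) * m0 + t * m1) - ereal a"
      by (intro ereal_minus_mono max_corr_convex_comb_le X \<nu>) (use t m0 m1 in auto)
    also have "\<dots> = ereal (1 - t) * (ereal m0 - ereal a) + ereal t * (ereal m1 - ereal a)"
      by (simp add: algebra_simps)
    also have "\<dots> \<le> ereal (1 - t) * \<phi> (push M X0) + ereal t * \<phi> (push M X1)"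
      using t le[OF mem push_in_P2[OF X(1)] m0] le[OF mem push_in_P2[OF X(2)] m1]
      by (intro add_mono ereal_mult_left_mono) simp_all
    finally show "max_corr (push M (\<lambda>q. (1 - t) *\<^sub>R X0 q + t *\<^sub>R X1 q)) \<nu> - ereal a \<le>
        ereal (1 - t) * \<phi> (push M X0) + ereal t * \<phi> (push M X1)" .
  qed
  then show "\<phi> (distr \<gamma> borel (\<lambda>(x1, x2). (1 - t) *\<^sub>R x1 + t *\<^sub>R x2)) \<le>
      ereal (1 - t) * \<phi> (distr \<gamma> borel fst) + ereal t * \<phi> (distr \<gamma> borel snd)"
    unfolding marg .
qed

text \<open>Below the supremum one pair \<open>(\<nu>, a)\<close> already witnesses the strict
  inequality, and lower semicontinuity of its correlation gives the radius.\<close>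

lemma sup_imp_lsc:
  fixes \<phi> :: "'h::{real_inner, polish_space} measure \<Rightarrow> ereal"
  assumes G: "G \<subseteq> P2 \<times> UNIV"
    and eq: "\<And>\<mu>. \<mu> \<in> P2 \<Longrightarrow> \<phi> \<mu> = (SUP (\<nu>, a)\<in>G. max_corr \<mu> \<nu> - ereal a)"
  shows "lsc_on P2 w2 \<phi>"
  unfolding lsc_on_def
proof (intro ballI allI impI)
  fix \<mu> :: "'h measure" and c assume \<mu>: "\<mu> \<in> P2" and "c < \<phi> \<mu>"
  then obtain \<nu> a where G': "(\<nu>, a) \<in> G" and "c < max_corr \<mu> \<nu> - ereal a"
    unfolding eq[OF \<mu>] less_SUP_iff by auto
  moreover have shift: "c < m - ereal a \<longleftrightarrow> c + ereal a < m" for m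
    by (cases c; cases m) auto
  ultimately have "c + ereal a < max_corr \<mu> \<nu>" by simp
  moreover have "\<nu> \<in> P2" using G G' by auto
  ultimately obtain d where d: "d > 0" "\<And>\<mu>'. \<mu>' \<in> P2 \<Longrightarrow> w2 \<mu> \<mu>' < d \<Longrightarrow> c + ereal a < max_corr \<mu>' \<nu>"
    using lsc_max_corr[of \<nu>] \<mu> unfolding lsc_on_def by blast
  have "c < \<phi> \<mu>'" if "\<mu>' \<in> P2" "w2 \<mu> \<mu>' < d" for \<mu>'
  proof -
    have "c < max_corr \<mu>' \<nu> - ereal a" using d(2)[OF that] by (simp add: shift)
    also have "\<dots> \<le> \<phi> \<mu>'" unfolding eq[OF that(1)] by (rule SUP_upper2[OF G']) simp
    finally show ?thesis .
  qed
  then show "\<exists>d>0. \<forall>\<mu>'\<in>P2. w2 \<mu> \<mu>' < d \<longrightarrow> c < \<phi> \<mu>'" using d(1) by blast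
qed

end

theorem corollary3p10:
  fixes \<phi> :: "'h::{real_inner, polish_space} measure \<Rightarrow> ereal"
    and M :: "'q measure"
  assumes "standard_borel M" and "prob_space M" and "nonatomic M"
    and "\<And>\<mu>. \<mu> \<in> P2 \<Longrightarrow> \<phi> \<mu> \<noteq> -\<infinity>"
    and "proper_on P2 \<phi>"
  defines "stmt1 \<equiv> totally_convex \<phi> \<and> lsc_on P2 w2 \<phi>"
    and "stmt2 \<equiv> convex_L2 M (\<phi> \<circ> push M) \<and> lsc_on (L2_space M) (L2_distance M) (\<phi> \<circ> push M)"
    and "stmt3 \<equiv> (\<forall>\<mu>\<in>P2. \<phi> \<mu> = kl_conj (kl_conj \<phi>) \<mu>)"
    and "stmt4 \<equiv> (\<exists>G. G \<subseteq> P2 \<times> (UNIV :: real set) \<and>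
                     (\<forall>\<mu>\<in>P2. \<phi> \<mu> = (SUP (\<nu>, a)\<in>G. max_corr \<mu> \<nu> - ereal a)))"
  shows "(stmt1 \<longleftrightarrow> stmt2) \<and> (stmt2 \<longleftrightarrow> stmt3) \<and> (stmt3 \<longleftrightarrow> stmt4)"
proof -
  interpret prob_space M by fact
  interpret atomless_prob_space M
    by unfold_locales (metis nonatomic_standard_borel_atomless_rv[OF assms(1,3)])
  have "stmt1 \<Longrightarrow> stmt2"
    unfolding stmt1_def stmt2_def using totally_convex_imp_convex_L2 lsc_w2_imp_lsc_L2 by blast
  moreover have "stmt2 \<Longrightarrow> stmt3"
    unfolding stmt2_def stmt3_def using lagrangian_imp_biconjugate[OF assms(4,5)] by blast
  moreover have "stmt4" if "stmt3"
    unfolding stmt4_def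
  proof (intro exI conjI ballI)
    show "{(\<nu>, a). \<nu> \<in> P2 \<and> kl_conj \<phi> \<nu> = ereal a} \<subseteq> P2 \<times> UNIV" by auto
  qed (rule biconjugate_imp_sup[OF assms(4,5)], use that in \<open>auto simp: stmt3_def\<close>)
  moreover have "stmt4 \<Longrightarrow> stmt1"
    unfolding stmt1_def stmt4_def using sup_imp_totally_convex sup_imp_lsc by blast
  ultimately show ?thesis by blast
qed

end
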